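(* Let $\mu,\nu,\lambda$ be partitions contained in $D$. For every $T\in\mathrm{LR}(\mu,\nu,\lambda)$ one has $e\bullet T=\bullet eT$. Setting $\rho:=\bullet e=e\bullet$, the map $\rho:\mathrm{LR}(\mu,\nu,\lambda)\to\mathrm{LR}(\lambda,\nu,\mu)$, $T\mapsto e\bullet T$, is a bijection which is an involution on $\mathrm{LR}(\mu,\nu,\lambda)\cup\mathrm{LR}(\lambda,\nu,\mu)$ (an LR commuter); it exhibits $c_{\mu,\nu,\lambda}=c_{\lambda,\nu,\mu}$.
   Context: Fix $0<d<n$; $D$ is the rectangle with boxes $(i,j)$, $1\le i\le d$ (rows bottom to top), $1\le j\le n-d$. Partitions in $D$ are Young diagrams in French convention; $\lambda^\vee=(n-d-\lambda_d,\dots,n-d-\lambda_1)$ is the complement in $D$. Tableaux are semistandard (rows weakly increasing left to right, columns strictly increasing upward); the word of a tableau reads rows right to left from the bottom row upward. An LR tableau is one whose word is Yamanouchi (every prefix has at least as many letters $i$ as $i+1$). $\mathrm{LR}(\mu,\nu,\lambda)$ is the set of LR tableaux of shape $\lambda^\vee/\mu$ and content $\nu$; $c_{\mu,\nu,\lambda}$ is its cardinality. Rotation: for a tableau $T$ in $D$ with entries in $[d]$, $\bullet T$ moves the entry in box $(i,j)$ to $(d+1-i,n-d+1-j)$ and replaces each entry $k$ by $d+1-k$. For a word $w$, $P(w),Q(w)$ are the insertion and standard recording tableaux under successive column insertion of its letters from left to right; two tableaux are Knuth equivalent if their words have the same $P$, and two tableaux of the same shape are dual equivalent if their words have the same $Q$.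 Reversal: for a tableau $T$ in $D$ with entries in $[d]$, $eT$ is the unique tableau of the same shape as $T$ that is dual equivalent to $T$ and Knuth equivalent to $\bullet T$. *)

theory Defs
  imports Main
begin

section \<open>Partitions in the rectangle\<close>

text \<open>
  Throughout, \<open>D\<close> is the rectangle with \<open>d\<close> rows and \<open>n - d\<close> columns. A partition contained in
  \<open>D\<close> is the list \<open>[\<lambda>\<^sub>1, \<dots>, \<lambda>\<^sub>d]\<close> of its \<open>d\<close> parts, zeros included; list indices start at 0,
  whereas rows, columns and entries start at 1.
\<close>

definition partition_in :: "nat \<Rightarrow> nat \<Rightarrow> nat list \<Rightarrow> bool" where
  "partition_in d n p \<longleftrightarrow>
     length p = d \<and> (\<forall>x\<in>set p. x \<le> n - d) \<and> (\<forall>i j. i < j \<and> j < d \<longrightarrow> p ! j \<le> p ! i)"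

definition complement :: "nat \<Rightarrow> nat \<Rightarrow> nat list \<Rightarrow> nat list" where
  "complement d n p = map (\<lambda>x. n - d - x) (rev p)"

definition contained :: "nat \<Rightarrow> nat list \<Rightarrow> nat list \<Rightarrow> bool" where
  "contained d p q \<longleftrightarrow> (\<forall>i<d. p ! i \<le> q ! i)"

definition rectangle :: "nat \<Rightarrow> nat \<Rightarrow> (nat \<times> nat) set" where
  "rectangle d n = {1..d} \<times> {1..n - d}"

text \<open>The boxes of the skew diagram \<open>q/p\<close>; row 1 is the bottom row.\<close>

definition skew_shape :: "nat \<Rightarrow> nat list \<Rightarrow> nat list \<Rightarrow> (nat \<times> nat) set" where
  "skew_shape d q p = {(i, j). 1 \<le> i \<and> i \<le> d \<and> p ! (i - 1) < j \<and> j \<le> q ! (i - 1)}"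


section \<open>Tableaux\<close>

text \<open>A filling assigns entries to the boxes in its domain; the domain is its shape.\<close>

type_synonym filling = "nat \<times> nat \<Rightarrow> nat option"

definition semistandard :: "filling \<Rightarrow> bool" where
  "semistandard T \<longleftrightarrow>
     0 \<notin> ran T \<and>
     (\<forall>i j j' x y. j < j' \<and> T (i, j) = Some x \<and> T (i, j') = Some y \<longrightarrow> x \<le> y) \<and>
     (\<forall>i i' j x y. i < i' \<and> T (i, j) = Some x \<and> T (i', j) = Some y \<longrightarrow> x < y)"

text \<open>Rows are read from right to left, starting with the bottom row.\<close>

definition word :: "nat \<Rightarrow> nat \<Rightarrow> filling \<Rightarrow> nat list" where
  "word d n T =
     concat (map (\<lambda>i. List.map_filter (\<lambda>j. T (i, j)) (rev [1..<n - d + 1])) [1..<d + 1])"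

definition has_content :: "nat \<Rightarrow> filling \<Rightarrow> nat list \<Rightarrow> bool" where
  "has_content d T c \<longleftrightarrow>
     (\<forall>k. card {b. T b = Some k} = (if 1 \<le> k \<and> k \<le> d then c ! (k - 1) else 0))"

definition yamanouchi :: "nat list \<Rightarrow> bool" where
  "yamanouchi w \<longleftrightarrow>
     (\<forall>l\<le>length w. \<forall>i\<ge>1. count_list (take l w) (i + 1) \<le> count_list (take l w) i)"

text \<open>
  The containment condition is needed because \<open>skew_shape\<close> is also defined, as a set of boxes,
  when the inner partition is not contained in the outer one.
\<close>

definition LR :: "nat \<Rightarrow> nat \<Rightarrow> nat list \<Rightarrow> nat list \<Rightarrow> nat list \<Rightarrow> filling set" where
  "LR d n mu nu lam =
     {T. contained d mu (complement d n lam) \<and>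
         dom T = skew_shape d (complement d n lam) mu \<and>
         semistandard T \<and> has_content d T nu \<and> yamanouchi (word d n T)}"

definition lr_coeff :: "nat \<Rightarrow> nat \<Rightarrow> nat list \<Rightarrow> nat list \<Rightarrow> nat list \<Rightarrow> nat" where
  "lr_coeff d n mu nu lam = card (LR d n mu nu lam)"

definition rotate_tab :: "nat \<Rightarrow> nat \<Rightarrow> filling \<Rightarrow> filling" where
  "rotate_tab d n T =
     (\<lambda>(i, j). if (i, j) \<in> rectangle d n
               then map_option (\<lambda>k. d + 1 - k) (T (d + 1 - i, n - d + 1 - j))
               else None)"


section \<open>Column insertion\<close>

text \<open>
  Here a straight-shape tableau is the list of its columns from left to right, each column listed
  from bottom to top. Inserting \<open>x\<close> into a (strictly increasing) column replaces its smallest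
  entry \<open>\<ge> x\<close>, which is bumped, or puts \<open>x\<close> on top if there is no such entry.
\<close>

fun bump :: "nat \<Rightarrow> nat list \<Rightarrow> nat list \<times> nat option" where
  "bump x [] = ([x], None)"
| "bump x (y # ys) =
     (if x \<le> y then (x # ys, Some y) else (let (zs, r) = bump x ys in (y # zs, r)))"

text \<open>Besides the new tableau, \<open>column_insert\<close> returns the index of the column that has grown.\<close>

fun column_insert :: "nat \<Rightarrow> nat list list \<Rightarrow> nat list list \<times> nat" where
  "column_insert x [] = ([[x]], 0)"
| "column_insert x (c # cs) =
     (case bump x c of
        (c', None) \<Rightarrow> (c' # cs, 0)
      | (c', Some y) \<Rightarrow> (let (cs', m) = column_insert y cs in (c' # cs', m + 1)))"

definition add_box :: "nat \<Rightarrow> nat \<Rightarrow> nat list list \<Rightarrow> nat list list" where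
  "add_box m k Q = (if m < length Q then Q[m := Q ! m @ [k]] else Q @ [[k]])"

definition insert_record ::
    "nat \<times> nat \<Rightarrow> nat list list \<times> nat list list \<Rightarrow> nat list list \<times> nat list list" where
  "insert_record = (\<lambda>(k, x) (P, Q). let (P', m) = column_insert x P in (P', add_box m k Q))"

definition PQ :: "nat list \<Rightarrow> nat list list \<times> nat list list" where
  "PQ w = fold insert_record (zip [1..<length w + 1] w) ([], [])"

definition P_tab :: "nat list \<Rightarrow> nat list list" where
  "P_tab w = fst (PQ w)"

definition Q_tab :: "nat list \<Rightarrow> nat list list" where
  "Q_tab w = snd (PQ w)"

definition knuth_equiv :: "nat \<Rightarrow> nat \<Rightarrow> filling \<Rightarrow> filling \<Rightarrow> bool" where
  "knuth_equiv d n T U \<longleftrightarrow> P_tab (word d n T) = P_tab (word d n U)"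

definition dual_equiv :: "nat \<Rightarrow> nat \<Rightarrow> filling \<Rightarrow> filling \<Rightarrow> bool" where
  "dual_equiv d n T U \<longleftrightarrow> dom T = dom U \<and> Q_tab (word d n T) = Q_tab (word d n U)"


section \<open>Reversal\<close>

text \<open>
  Entries in \<open>[d]\<close> need not be required of \<open>U\<close>: Knuth equivalent tableaux have the same content.
\<close>

definition reversal :: "nat \<Rightarrow> nat \<Rightarrow> filling \<Rightarrow> filling" where
  "reversal d n T =
     (THE U. semistandard U \<and> dom U = dom T \<and>
             dual_equiv d n U T \<and> knuth_equiv d n U (rotate_tab d n T))"

definition rho :: "nat \<Rightarrow> nat \<Rightarrow> filling \<Rightarrow> filling" where
  "rho d n T = reversal d n (rotate_tab d n T)"

end

theory Submission
  imports Defs "HOL-Library.Multiset"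
begin

text \<open>
  The proof uses the crystal lowering operators, which change one letter \<open>i\<close> of a word into \<open>i + 1\<close>.
  They preserve the recording tableau, they turn the word of a semistandard filling of a skew shape
  into the word of another one, and the dual word (reverse it and replace every \<open>k\<close> by \<open>d + 1 - k\<close>, which
  is what rotation does to words) reverses their direction. Lowering an LR tableau \<open>T\<close> as long as possible
  gives a filling \<open>U\<close> with a lowest weight word. The insertion tableau of a highest or lowest weight
  word is determined by its shape, so \<open>U\<close> is Knuth equivalent to the rotation of \<open>T\<close>, and the rotation
  of \<open>U\<close> is Knuth equivalent to \<open>T\<close>. Hence \<open>U\<close> is the reversal of \<open>T\<close>, the rotation of \<open>U\<close> is the
  reversal of the rotation of \<open>T\<close>, and \<open>T\<close> is the reversal of \<open>U\<close>; this gives all the claims.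
\<close>

section \<open>Bracketing and lowering of words\<close>

text \<open>\<open>reversal\<close> is a definite description, so a candidate must be exhibited and
  shown to be unique; uniqueness comes from the injectivity of
  \<open>w \<mapsto> (P_tab w, Q_tab w)\<close>. The rest hinges on two facts. Column insertion
  rewrites the column reading word of a tableau without changing the numbers of unmatched brackets,
  for every \<open>i\<close>. These numbers decide which factor of a word contains the lowered
  letter, so lowering can be followed through each bump, and the same column grows on both sides.
  Knuth equivalence of the candidate with the rotation of \<open>T\<close> further requires equal
  shapes, and since rotation may change the recording tableau, these are obtained from the content:
  in a highest weight word the letter \<open>i\<close> occurs as often as the insertion tableau has
  columns of height at least \<open>i\<close>, in a lowest weight word the same holds for the letter
  \<open>d + 1 - i\<close>, and passing to the dual word exchanges the two letters.\<close>

text \<open>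
  Reading \<open>i\<close> as an opening and \<open>i + 1\<close> as a closing bracket, \<open>clo\<close> and \<open>opn\<close> count the
  unmatched \<open>i + 1\<close>'s and the unmatched \<open>i\<close>'s.
\<close>

fun clo :: "nat \<Rightarrow> nat list \<Rightarrow> nat" where
  "clo i [] = 0"
| "clo i (x # w) = (if x = Suc i then Suc (clo i w) else if x = i then clo i w - 1 else clo i w)"

fun opn :: "nat \<Rightarrow> nat list \<Rightarrow> nat" where
  "opn i [] = 0"
| "opn i (x # w) = (if x = i \<and> clo i w = 0 then Suc (opn i w) else opn i w)"

text \<open>The unmatched \<open>i\<close>'s of \<open>u\<close> pair up with the unmatched
  \<open>i + 1\<close>'s of \<open>v\<close>; truncated subtraction leaves the surplus on its own
  side. Hence a factor of a word may be replaced by any other with the same two numbers.\<close>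

lemma clo_opn_append:
  "clo i (u @ v) = clo i u + (clo i v - opn i u) \<and> opn i (u @ v) = opn i v + (opn i u - clo i v)"
  by (induction u) auto

lemma clo_append [simp]: "clo i (u @ v) = clo i u + (clo i v - opn i u)"
  and opn_append [simp]: "opn i (u @ v) = opn i v + (opn i u - clo i v)"
  using clo_opn_append by blast+

lemma clo_eq_0: "Suc i \<notin> set w \<Longrightarrow> clo i w = 0"
  by (induction w) auto

lemma opn_eq_0: "i \<notin> set w \<Longrightarrow> opn i w = 0"
  by (induction w) auto

text \<open>Both \<open>count_list w (Suc i) - clo i w\<close> and
  \<open>count_list w i - opn i w\<close> are the number of matched pairs.\<close>

lemma count_clo_opn: "count_list w (Suc i) + opn i w = count_list w i + clo i w"
  by (induction w) auto

lemma clo_eq_0_iff: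
  "clo i w = 0 \<longleftrightarrow> (\<forall>l\<le>length w. count_list (take l w) (Suc i) \<le> count_list (take l w) i)"
proof (induction w rule: rev_induct)
  case (snoc x w)
  have "clo i (w @ [x]) = 0 \<longleftrightarrow>
      clo i w = 0 \<and> count_list (w @ [x]) (Suc i) \<le> count_list (w @ [x]) i"
    using count_clo_opn[of w i] by auto
  also have "\<dots> \<longleftrightarrow> (\<forall>l\<le>length (w @ [x]).
      count_list (take l (w @ [x])) (Suc i) \<le> count_list (take l (w @ [x])) i)"
    by (auto simp: snoc le_Suc_eq)
  finally show ?case .
qed simp

text \<open>So Yamanouchi words are the highest weight words: an unmatched \<open>i + 1\<close> is
  what a raising operator would change.\<close>

lemma yamanouchi_iff_clo: "yamanouchi w \<longleftrightarrow> (\<forall>i\<ge>1. clo i w = 0)"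
  unfolding yamanouchi_def clo_eq_0_iff by auto

text \<open>In an increasing column \<open>i\<close> precedes \<open>i + 1\<close> and each occurs
  at most once, so they match whenever both are present.\<close>

lemma clo_column:
  "sorted_wrt (<) c \<Longrightarrow> clo i c = (if Suc i \<in> set c \<and> i \<notin> set c then 1 else 0)"
  by (induction c) (auto simp: clo_eq_0 split: if_splits)

lemma opn_column:
  "sorted_wrt (<) c \<Longrightarrow> opn i c = (if i \<in> set c \<and> Suc i \<notin> set c then 1 else 0)"
proof (induction c)
  case (Cons a c)
  then have "a \<notin> set c" by auto
  with Cons show ?case by (auto simp: opn_eq_0 clo_column)
qed simp

text \<open>The crystal operator \<open>f\<^sub>i\<close> as a relation: the changed letter is the leftmost unmatched \<open>i\<close>.\<close>

definition lowers :: "nat \<Rightarrow> nat list \<Rightarrow> nat list \<Rightarrow> bool" where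
  "lowers i u v \<longleftrightarrow>
     (\<exists>a b. u = a @ i # b \<and> v = a @ Suc i # b \<and> opn i a = 0 \<and> clo i b = 0)"

lemma lowersI: "opn i a = 0 \<Longrightarrow> clo i b = 0 \<Longrightarrow> lowers i (a @ i # b) (a @ Suc i # b)"
  unfolding lowers_def by blast

lemma lowers_ConsI: "clo i b = 0 \<Longrightarrow> lowers i (i # b) (Suc i # b)"
  using lowersI[of i "[]"] by simp

lemma lowers_length: "lowers i u v \<Longrightarrow> length v = length u"
  unfolding lowers_def by auto

lemma lowers_irrefl: "\<not> lowers i u u"
  unfolding lowers_def by auto

lemma ex_lowers: "0 < opn i u \<Longrightarrow> \<exists>v. lowers i u v"
proof (induction u)
  case (Cons x u)
  show ?case
  proof (cases "0 < opn i u \<and> \<not> (x = i \<and> clo i u = 0)")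
    case True
    then obtain v where "lowers i u v" using Cons.IH by blast
    then obtain a b where ab: "u = a @ i # b" "opn i a = 0" "clo i b = 0"
      unfolding lowers_def by blast
    then have "clo i u = clo i a" by simp
    with True ab(2) have "opn i (x # a) = 0" by simp
    with ab show ?thesis using lowersI[of i "x # a" b] by auto
  next
    case False
    with Cons.prems have "x = i" "clo i u = 0" by (auto split: if_splits)
    then show ?thesis using lowers_ConsI by auto
  qed
qed simp

text \<open>The tensor product rule for crystals: the leftmost unmatched \<open>i\<close> lies in
  \<open>u\<close> exactly when \<open>u\<close> has more unmatched \<open>i\<close>'s than
  \<open>v\<close> can close. The length assumption fixes where the lowered word is cut.\<close>

lemma lowers_append:
  assumes "length u' = length u"
  shows "lowers i (u @ v) (u' @ v') \<longleftrightarrow>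
    lowers i u u' \<and> v' = v \<and> clo i v < opn i u \<or> u' = u \<and> lowers i v v' \<and> opn i u \<le> clo i v"
    (is "?L \<longleftrightarrow> ?R")
proof
  assume ?L
  then obtain a b where ab: "u @ v = a @ i # b" "u' @ v' = a @ Suc i # b"
    "opn i a = 0" "clo i b = 0"
    unfolding lowers_def by blast
  show ?R
  proof (cases "length a < length u")
    case True
    then obtain c where c: "u = a @ i # c" "b = c @ v"
      using ab(1) by (auto simp: append_eq_append_conv2 Cons_eq_append_conv append_eq_Cons_conv)
    with ab(2) have "(u' @ v') = (a @ Suc i # c) @ v" by simp
    moreover have "length u' = length (a @ Suc i # c)" using assms c by simp
    ultimately have "u' = a @ Suc i # c \<and> v' = v" using append_eq_append_conv by blast
    then show ?thesis using c ab by (auto intro!: lowersI)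
  next
    case False
    then obtain c where c: "a = u @ c" "v = c @ i # b"
      using ab(1) by (auto simp: append_eq_append_conv2 Cons_eq_append_conv append_eq_Cons_conv)
    with ab(2) have "u' @ v' = u @ c @ Suc i # b" by simp
    with assms have "u' = u" "v' = c @ Suc i # b" by auto
    then show ?thesis using c ab by (auto intro: lowersI)
  qed
next
  assume ?R
  then show ?L
  proof (elim disjE conjE)
    assume "lowers i u u'" and *: "v' = v" "clo i v < opn i u"
    then obtain a b where ab: "u = a @ i # b" "u' = a @ Suc i # b" "opn i a = 0" "clo i b = 0"
      unfolding lowers_def by blast
    with * have "clo i (b @ v) = 0" by simp
    with ab * show ?L using lowersI[of i a "b @ v"] by simp
  next
    assume "lowers i v v'" and *: "u' = u" "opn i u \<le> clo i v"
    then obtain a b where ab: "v = a @ i # b" "v' = a @ Suc i # b" "opn i a = 0" "clo i b = 0"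
      unfolding lowers_def by blast
    with * have "opn i (u @ a) = 0" by simp
    with ab * show ?L using lowersI[of i "u @ a" b] by simp
  qed
qed

section \<open>Bumping into a single column\<close>

lemma bump_append:
  "\<forall>z\<in>set l. z < x \<Longrightarrow> bump x (l @ c) = (l @ fst (bump x c), snd (bump x c))"
  by (induction l) (auto simp: split_beta)

lemma bump_None: "\<forall>z\<in>set c. z < x \<Longrightarrow> bump x c = (c @ [x], None)"
  using bump_append[of c x "[]"] by simp

lemma bump_Some: "\<forall>z\<in>set l. z < x \<Longrightarrow> x \<le> y \<Longrightarrow> bump x (l @ y # h) = (l @ x # h, Some y)"
  using bump_append[of l x "y # h"] by simp

lemma bump_cases:
  obtains (None) "\<forall>z\<in>set c. z < x" "bump x c = (c @ [x], None)"
  | (Some) l y h where "c = l @ y # h" "\<forall>z\<in>set l. z < x" "x \<le> y"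
      "bump x c = (l @ x # h, Some y)"
proof (cases "\<forall>z\<in>set c. z < x")
  case True
  then show ?thesis using bump_None that(1) by blast
next
  case False
  then have "\<exists>y\<in>set c. x \<le> y" by force
  then obtain l y h where "c = l @ y # h" "x \<le> y" "\<forall>z\<in>set l. \<not> x \<le> z"
    using split_list_first_prop[of c "\<lambda>y. x \<le> y"] by blast
  then show ?thesis using that(2)[of l y h] bump_Some[of l x y h] by force
qed

text \<open>With the bumped entry as a word of length at most one, a bump becomes the rewriting of
  \<open>c @ [x]\<close> into \<open>opt_list r @ c'\<close>.\<close>

fun opt_list :: "'a option \<Rightarrow> 'a list" where
  "opt_list None = []"
| "opt_list (Some x) = [x]"

lemma bump_sorted:
  assumes "sorted_wrt (<) c" "bump x c = (c', r)"
  shows "sorted_wrt (<) c'"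
  using assms
  by (cases c x rule: bump_cases) (force simp: sorted_wrt_append)+

lemma bump_mset: "bump x c = (c', r) \<Longrightarrow> mset (opt_list r @ c') = add_mset x (mset c)"
  by (cases c x rule: bump_cases) auto

text \<open>Each side consists of an increasing column and at most one further letter, so only the
  presence of \<open>i\<close> and \<open>i + 1\<close> matters. If \<open>x\<close> replaces
  \<open>y\<close>, the other entries of the column avoid the interval from \<open>x\<close> to
  \<open>y\<close>, which leaves a finite case check.\<close>

lemma bump_clo_opn:
  assumes c: "sorted_wrt (<) c" and b: "bump x c = (c', r)"
  shows "clo i (opt_list r @ c') = clo i (c @ [x])" "opn i (opt_list r @ c') = opn i (c @ [x])"
proof -
  have c': "sorted_wrt (<) c'" using bump_sorted[OF c b] .
  have "clo i (opt_list r @ c') = clo i (c @ [x]) \<and> opn i (opt_list r @ c') = opn i (c @ [x])"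
  proof (cases c x rule: bump_cases)
    case None
    then show ?thesis using b by auto
  next
    case (Some l y h)
    then have e: "c' = l @ x # h" "r = Some y" using b by auto
    have "\<forall>z\<in>set l. z < y" "\<forall>z\<in>set h. y < z" using c Some(1) by (auto simp: sorted_wrt_append)
    then have *: "x \<notin> set l" "y \<notin> set l" "x \<notin> set h" "y \<notin> set h"
      "\<forall>z. z \<in> set l \<longrightarrow> z < x" "\<forall>z. z \<in> set h \<longrightarrow> y < z"
      using Some by fastforce+
    have "set c = insert y (set l \<union> set h)" "set c' = insert x (set l \<union> set h)"
      using Some e by auto
    then have "k \<in> set c \<longleftrightarrow> k = y \<or> k \<in> set l \<union> set h"
      "k \<in> set c' \<longleftrightarrow> k = x \<or> k \<in> set l \<union> set h" for k by auto
    then have cc: "clo i c = (if (Suc i = y \<or> Suc i \<in> set l \<union> set h) \<and> i \<noteq> y \<and> i \<notin> set l \<union> set h then 1 else 0)"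
      "clo i c' = (if (Suc i = x \<or> Suc i \<in> set l \<union> set h) \<and> i \<noteq> x \<and> i \<notin> set l \<union> set h then 1 else 0)"
      "opn i c = (if (i = y \<or> i \<in> set l \<union> set h) \<and> Suc i \<noteq> y \<and> Suc i \<notin> set l \<union> set h then 1 else 0)"
      "opn i c' = (if (i = x \<or> i \<in> set l \<union> set h) \<and> Suc i \<noteq> x \<and> Suc i \<notin> set l \<union> set h then 1 else 0)"
      using clo_column[OF c, of i] clo_column[OF c', of i] opn_column[OF c, of i] opn_column[OF c', of i]
      by auto
    have k: "x \<noteq> k \<or> k \<notin> set l \<union> set h" "y \<noteq> k \<or> k \<notin> set l \<union> set h"
      "k \<in> set l \<union> set h \<Longrightarrow> k < x \<or> y < k" for k using * by auto
    show ?thesis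
      unfolding e(2) opt_list.simps append_Cons append_Nil clo_append opn_append clo.simps opn.simps cc
      using k(1)[of i] k(2)[of i] k(3)[of i] k(1)[of "Suc i"] k(2)[of "Suc i"] k(3)[of "Suc i"] \<open>x \<le> y\<close>
      by (cases "i \<in> set l \<union> set h"; cases "Suc i \<in> set l \<union> set h") auto
  qed
  then show "clo i (opt_list r @ c') = clo i (c @ [x])" "opn i (opt_list r @ c') = opn i (c @ [x])"
    by blast+
qed

text \<open>The lowered letter is either an entry of the column or the inserted letter; what has to
  be tracked is whether it then stays in the column or becomes the bumped letter.\<close>

lemma bump_lowers:
  assumes c: "sorted_wrt (<) c" and c1: "sorted_wrt (<) c1" and len: "length c1 = length c"
    and F: "lowers i (c @ [x]) (c1 @ [x1])"
    and b: "bump x c = (c', r)" and b1: "bump x1 c1 = (c1', r1)"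
  shows "lowers i (opt_list r @ c') (opt_list r1 @ c1') \<and> (r = None \<longleftrightarrow> r1 = None)"
proof -
  consider (col) "lowers i c c1" "x1 = x" "clo i [x] < opn i c"
    | (letter) "c1 = c" "lowers i [x] [x1]" "opn i c \<le> clo i [x]"
    using F len by (auto simp: lowers_append)
  then show ?thesis
  proof cases
    case letter
    then have x: "x = i" "x1 = Suc i" by (auto simp: lowers_def Cons_eq_append_conv)
    with letter have o: "opn i c = 0" by simp
    show ?thesis
    proof (cases c i rule: bump_cases)
      case None
      then have "\<forall>z\<in>set c. z < Suc i" by auto
      with None bump_None[of c "Suc i"] show ?thesis using F b b1 letter x by auto
    next
      case (Some l y h)
      have h: "\<forall>z\<in>set h. y < z" "sorted_wrt (<) h" using c Some(1) by (auto simp: sorted_wrt_append)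
      show ?thesis
      proof (cases "y = i")
        \<comment> \<open>As \<open>opn i c = 0\<close>, the entry \<open>i\<close> of the column is
          matched by an \<open>i + 1\<close> directly above it. Inserting \<open>i\<close> bumps
          \<open>i\<close>, inserting \<open>i + 1\<close> bumps \<open>i + 1\<close>; the column is
          unchanged and the lowering passes to the bumped letter.\<close>
        case True
        then have ic: "i \<in> set c" using Some by auto
        then have ic2: "Suc i \<in> set c" using o opn_column[OF c, of i] by (auto split: if_splits)
        then have "Suc i \<in> set h" using Some True by fastforce
        then obtain z h' where zh: "h = z # h'" by (cases h) auto
        then have "z = Suc i" using h \<open>Suc i \<in> set h\<close> True by fastforce
        with zh True have "bump (Suc i) c = (c, Some (Suc i))"
          using bump_Some[of "l @ [i]" "Suc i" "Suc i" h'] Some by force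
        moreover have "bump i c = (c, Some i)" using Some True by simp
        moreover have "clo i c = 0" using ic clo_column[OF c] by simp
        ultimately show ?thesis using b b1 x letter(1) by (auto intro: lowers_ConsI)
      next
        case False
        then have "i < y" using Some by simp
        then have "bump (Suc i) c = (l @ Suc i # h, Some y)"
          using bump_Some[of l "Suc i" y h] Some by force
        moreover have "opn i (y # l) = 0" "clo i h = 0"
          using Some h \<open>i < y\<close> by (fastforce intro!: opn_eq_0 clo_eq_0)+
        ultimately show ?thesis
          using b b1 x letter(1) Some(4) lowersI[of i "y # l" h] by auto
      qed
    qed
  next
    case col
    \<comment> \<open>A column has at most one unmatched \<open>i\<close>, so
      \<open>clo i [x] < opn i c\<close> excludes \<open>x = Suc i\<close>, which would match
      it.\<close>
    then have i: "i \<in> set c" "Suc i \<notin> set c" "x \<noteq> Suc i"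
      using opn_column[OF c, of i] by (auto split: if_splits)
    from col obtain p q where pq: "c = p @ i # q" "c1 = p @ Suc i # q"
      unfolding lowers_def by blast
    with c have p: "\<forall>z\<in>set p. z < i" and q: "\<forall>z\<in>set q. i < z" by (auto simp: sorted_wrt_append)
    have q': "\<forall>z\<in>set q. Suc i < z" using q i(2) pq by (metis Suc_lessI Un_iff list.set_intros(2) set_append)
    show ?thesis
    proof (cases "x \<le> i")
      case True
      show ?thesis
      proof (cases p x rule: bump_cases)
        \<comment> \<open>Here \<open>x\<close> displaces the lowered entry itself, \<open>i\<close>
          in one column and \<open>i + 1\<close> in the other.\<close>
        case None
        then have "bump x c = (p @ x # q, Some i)" "bump x c1 = (p @ x # q, Some (Suc i))"
          using bump_Some[of p x i q] bump_Some[of p x "Suc i" q] True pq by auto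
        moreover have "clo i (p @ x # q) = 0"
          using p q' True by (intro clo_eq_0) fastforce
        ultimately show ?thesis using b b1 col lowers_ConsI[of i "p @ x # q"] by (auto simp del: clo_append)
      next
        case (Some l y h)
        then have "bump x c = (l @ x # h @ i # q, Some y)" "bump x c1 = (l @ x # h @ Suc i # q, Some y)"
          using bump_Some[of l x y "h @ i # q"] bump_Some[of l x y "h @ Suc i # q"] pq by auto
        moreover have "opn i (y # l @ x # h) = 0"
          using p Some by (intro opn_eq_0) auto
        moreover have "clo i q = 0" using q' by (intro clo_eq_0) auto
        ultimately show ?thesis using b b1 col lowersI[of i "y # l @ x # h" q] by auto
      qed
    next
      case False
      with i have x: "Suc i < x" by simp
      obtain q1 s where s: "bump x q = (q1, s)" by fastforce
      have "bump x c = (p @ i # q1, s)" "bump x c1 = (p @ Suc i # q1, s)"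
        using bump_append[of "p @ [i]" x q] bump_append[of "p @ [Suc i]" x q] s x p pq by force+
      moreover have "set (opt_list s) \<union> set q1 = insert x (set q)"
        using arg_cong[OF bump_mset[OF s], of set_mset] by simp
      then have "set (opt_list s) \<union> set q1 \<subseteq> {Suc i<..}" using q' x by auto
      then have "i \<notin> set (opt_list s @ p)" "Suc i \<notin> set q1" using p by auto
      then have "opn i (opt_list s @ p) = 0" "clo i q1 = 0"
        using opn_eq_0 clo_eq_0 by blast+
      ultimately show ?thesis using b b1 col lowersI[of i "opt_list s @ p" q1] by auto
    qed
  qed
qed


section \<open>Column insertion and lowering\<close>

text \<open>Columns are read from right to left, so that inserting into the first column acts at the
  end of the word and the bumped entry lands at the end of the word of the remaining
  columns.\<close>

definition column_word :: "nat list list \<Rightarrow> nat list" where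
  "column_word P = concat (rev P)"

lemma column_word_simps [simp]:
  "column_word [] = []" "column_word (c # P) = column_word P @ c"
  by (simp_all add: column_word_def)

lemma length_column_word: "length (column_word P) = sum_list (map length P)"
  by (induction P) auto

lemma column_word_eq_iff:
  "map length P = map length P' \<Longrightarrow> column_word P = column_word P' \<longleftrightarrow> P = P'"
proof (induction P arbitrary: P')
  case (Cons c P)
  then show ?case by (cases P') auto
qed simp

lemma column_insert_Cons:
  "column_insert x (c # cs) =
     (case snd (bump x c) of
        None \<Rightarrow> (fst (bump x c) # cs, 0)
      | Some y \<Rightarrow> (fst (bump x c) # fst (column_insert y cs), Suc (snd (column_insert y cs))))"
  by (auto simp: column_insert.simps(2) split_beta split: option.splits prod.splits)

lemma column_insert_Cons_Some:
  "bump x c = (c', Some y) \<Longrightarrow>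
    column_insert x (c # cs) = (c' # fst (column_insert y cs), Suc (snd (column_insert y cs)))"
  by (simp add: column_insert.simps(2) split_beta)

declare column_insert.simps(2) [simp del]

definition columns :: "nat list list \<Rightarrow> bool" where
  "columns P \<longleftrightarrow> (\<forall>c\<in>set P. sorted_wrt (<) c \<and> c \<noteq> [])"

lemma columns_simps [simp]:
  "columns []" "columns (c # P) \<longleftrightarrow> sorted_wrt (<) c \<and> c \<noteq> [] \<and> columns P"
  by (auto simp: columns_def)

lemma bump_not_Nil: "bump x c = (c', r) \<Longrightarrow> c' \<noteq> []"
  by (cases c x rule: bump_cases) auto

lemma columns_column_insert: "columns P \<Longrightarrow> columns (fst (column_insert x P))"
proof (induction P arbitrary: x)
  case (Cons c P)
  obtain c' r where b: "bump x c = (c', r)" by fastforce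
  with Cons bump_sorted[OF _ b] bump_not_Nil[OF b] show ?case
    by (cases r) (simp_all add: column_insert_Cons)
qed simp

lemma mset_column_insert:
  "mset (column_word (fst (column_insert x P))) = add_mset x (mset (column_word P))"
proof (induction P arbitrary: x)
  case (Cons c P)
  obtain c' r where b: "bump x c = (c', r)" by fastforce
  with Cons bump_mset[OF b] show ?case
    by (cases r) (simp_all add: column_insert_Cons flip: union_mset_add_mset_right)
qed simp

lemma clo_opn_column_insert:
  assumes "columns P"
  shows "clo i (column_word (fst (column_insert x P))) = clo i (column_word P @ [x]) \<and>
    opn i (column_word (fst (column_insert x P))) = opn i (column_word P @ [x])"
  using assms
proof (induction P arbitrary: x)
  case (Cons c P)
  obtain c' r where b: "bump x c = (c', r)" by fastforce
  let ?w = "column_word P @ opt_list r @ c'"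
  have "clo i (column_word (fst (column_insert x (c # P)))) = clo i ?w \<and>
    opn i (column_word (fst (column_insert x (c # P)))) = opn i ?w"
  proof (cases r)
    case None
    then show ?thesis using b by (simp add: column_insert_Cons)
  next
    case (Some y)
    with Cons have "clo i (column_word (fst (column_insert y P))) = clo i (column_word P @ [y])"
      "opn i (column_word (fst (column_insert y P))) = opn i (column_word P @ [y])" by auto
    moreover have "?w = (column_word P @ [y]) @ c'" using Some by simp
    ultimately show ?thesis
      using column_insert_Cons_Some[of x c c' y P] b Some
      by (simp only: fst_conv column_word_simps clo_append opn_append)
  qed
  moreover have "clo i (opt_list r @ c') = clo i (c @ [x])" "opn i (opt_list r @ c') = opn i (c @ [x])"
    using bump_clo_opn[OF _ b] Cons.prems by auto
  then have "clo i ?w = clo i (column_word P @ c @ [x])" "opn i ?w = opn i (column_word P @ c @ [x])"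
    by (metis clo_append opn_append)+
  ultimately show ?case by (simp only: column_word_simps append_assoc)
qed simp

text \<open>The counterpart of \<open>add_box\<close> for lists of column heights; the index
  \<open>length hs\<close> opens a new column.\<close>

definition grow :: "nat \<Rightarrow> nat list \<Rightarrow> nat list" where
  "grow m hs = (if m < length hs then hs[m := Suc (hs ! m)] else hs @ [1])"

lemma bump_length: "bump x c = (c', r) \<Longrightarrow> length c' = (if r = None then Suc (length c) else length c)"
  by (cases c x rule: bump_cases) auto

lemma column_insert_shape:
  "snd (column_insert x P) \<le> length P \<and>
   map length (fst (column_insert x P)) = grow (snd (column_insert x P)) (map length P)"
proof (induction P arbitrary: x)
  case (Cons c P)
  obtain c' r where b: "bump x c = (c', r)" by fastforce
  with Cons bump_length[OF b] show ?case
    by (cases r) (simp_all add: column_insert_Cons grow_def)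
qed (simp add: grow_def)

text \<open>
  Insertion replaces \<open>c @ [x]\<close> by \<open>opt_list r @ c'\<close> column by column without changing \<open>clo\<close> and
  \<open>opn\<close>. By \<open>lowers_append\<close>, the letter that is lowered therefore lies in corresponding factors
  before and after the insertion.
\<close>

lemma lowers_column_insert:
  assumes "columns P" "columns P1" "map length P = map length P1"
    and "lowers i (column_word P @ [x]) (column_word P1 @ [x1])"
  shows "snd (column_insert x P) = snd (column_insert x1 P1) \<and>
    lowers i (column_word (fst (column_insert x P))) (column_word (fst (column_insert x1 P1)))"
  using assms
proof (induction P arbitrary: P1 x x1)
  case Nil
  then show ?case by simp
next
  case (Cons c P)
  then obtain c1 P1' where P1: "P1 = c1 # P1'" by (cases P1) auto
  let ?P1 = P1'
  have len: "length (column_word ?P1) = length (column_word P)" "length c1 = length c"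
    "map length P = map length ?P1"
    using Cons.prems(3) P1 by (auto simp: length_column_word)
  obtain c' r where b: "bump x c = (c', r)" by fastforce
  obtain c1' r1 where b1: "bump x1 c1 = (c1', r1)" by fastforce
  have "lowers i (column_word P @ (c @ [x])) (column_word ?P1 @ (c1 @ [x1]))"
    using Cons.prems(4) P1 by simp
  from iffD1[OF lowers_append[OF len(1)] this]
  have "lowers i (column_word P @ (opt_list r @ c')) (column_word ?P1 @ (opt_list r1 @ c1')) \<and>
      (r = None \<longleftrightarrow> r1 = None)"
  proof (elim disjE conjE)
    assume *: "lowers i (column_word P) (column_word P1')" "c1 @ [x1] = c @ [x]"
      "clo i (c @ [x]) < opn i (column_word P)"
    then have "c1' = c'" "r1 = r" using b b1 by auto
    then show ?thesis using * bump_clo_opn[OF _ b] Cons.prems(1)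
      by (simp add: lowers_append[OF len(1)] del: clo_append opn_append)
  next
    assume *: "column_word P1' = column_word P" "lowers i (c @ [x]) (c1 @ [x1])"
      "opn i (column_word P) \<le> clo i (c @ [x])"
    then show ?thesis using bump_lowers[OF _ _ len(2) *(2) b b1] bump_clo_opn[OF _ b] Cons.prems(1,2) P1
      by (simp add: lowers_append del: clo_append opn_append)
  qed
  then have F: "lowers i (column_word P @ (opt_list r @ c')) (column_word ?P1 @ (opt_list r1 @ c1'))"
    and r: "r = None \<longleftrightarrow> r1 = None" by blast+
  show ?case
  proof (cases r)
    case None
    then show ?thesis using F r b b1 P1 by (simp add: column_insert_Cons)
  next
    case (Some y)
    then obtain y1 where y1: "r1 = Some y1" using r by auto
    have len2: "length (column_word ?P1 @ [y1]) = length (column_word P @ [y])" using len by simp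
    let ?ins = "\<lambda>y P. column_word (fst (column_insert y P))"
    have "map length (fst (column_insert y1 ?P1)) = map length (fst (column_insert y P))"
      if "snd (column_insert y P) = snd (column_insert y1 ?P1)"
      using that len(3) column_insert_shape[of y P] column_insert_shape[of y1 ?P1] by simp
    then have len3: "length (?ins y1 ?P1) = length (?ins y P)"
      if "snd (column_insert y P) = snd (column_insert y1 ?P1)"
      using that by (simp add: length_column_word)
    have co: "clo i (?ins y P) = clo i (column_word P @ [y])" "opn i (?ins y P) = opn i (column_word P @ [y])"
      using clo_opn_column_insert[of P i y] Cons.prems(1) by auto
    \<comment> \<open>The word is cut a second time, now behind the bumped letter: a lowering in
      front of the cut is handled by the induction hypothesis, one behind it leaves \<open>y\<close>
      and the remaining columns equal.\<close>
    have "lowers i ((column_word P @ [y]) @ c') ((column_word ?P1 @ [y1]) @ c1')"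
      using F Some y1 by simp
    from iffD1[OF lowers_append[OF len2] this]
    have "snd (column_insert y P) = snd (column_insert y1 ?P1) \<and>
        lowers i (?ins y P @ c') (?ins y1 ?P1 @ c1')"
    proof (elim disjE conjE)
      assume *: "lowers i (column_word P @ [y]) (column_word P1' @ [y1])" "c1' = c'"
        "clo i c' < opn i (column_word P @ [y])"
      have "snd (column_insert y P) = snd (column_insert y1 ?P1) \<and> lowers i (?ins y P) (?ins y1 ?P1)"
        using Cons.IH[OF _ _ len(3) *(1)] Cons.prems(1,2) P1 by auto
      then show ?thesis using * co lowers_append[OF len3] by simp
    next
      assume *: "column_word P1' @ [y1] = column_word P @ [y]" "lowers i c' c1'"
        "opn i (column_word P @ [y]) \<le> clo i c'"
      then have "y1 = y" "?P1 = P" using column_word_eq_iff[OF len(3)] by auto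
      then show ?thesis using * co by (simp add: lowers_append)
    qed
    then show ?thesis using b b1 Some y1 P1 by (simp add: column_insert_Cons)
  qed
qed

section \<open>Reverse insertion\<close>

text \<open>If nothing is bumped, the inserted letter is the top of the new column; if
  \<open>y\<close> is bumped, it is the largest entry \<open>\<le> y\<close>, since everything above
  it exceeds \<open>y\<close>.\<close>

lemma bump_inj:
  assumes "sorted_wrt (<) c" "sorted_wrt (<) c1" "bump x c = (c', r)" "bump x1 c1 = (c', r)"
  shows "x1 = x \<and> c1 = c"
proof (cases r)
  case None
  then show ?thesis using assms(3,4) by (cases c x rule: bump_cases; cases c1 x1 rule: bump_cases) auto
next
  case (Some y)
  obtain l h where c: "c = l @ y # h" "c' = l @ x # h" "x \<le> y"
    using assms(3) Some by (cases c x rule: bump_cases) auto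
  obtain l1 h1 where c1: "c1 = l1 @ y # h1" "c' = l1 @ x1 # h1" "x1 \<le> y"
    using assms(4) Some by (cases c1 x1 rule: bump_cases) auto
  have h: "\<forall>z\<in>set h. y < z" "\<forall>z\<in>set h1. y < z"
    using assms(1,2) c c1 by (auto simp: sorted_wrt_append)
  have "l @ x # h = l1 @ x1 # h1" using c c1 by simp
  then have "l = l1 \<and> x = x1 \<and> h = h1"
    using h c(3) c1(3)
    by (auto simp: append_eq_append_conv2 Cons_eq_append_conv append_eq_Cons_conv)
  then show ?thesis using c c1 by simp
qed

text \<open>The index of the grown column tells whether the first column passed on an entry, so
  insertion can be undone column by column. Nonempty columns keep the empty tableau apart from the
  others.\<close>

lemma column_insert_inj:
  assumes "columns P" "columns P1" "column_insert x P = column_insert x1 P1"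
  shows "x1 = x \<and> P1 = P"
  using assms
proof (induction P arbitrary: P1 x x1)
  case Nil
  show ?case
  proof (cases P1)
    case (Cons c1 P1')
    obtain c1' r1 where b: "bump x1 c1 = (c1', r1)" by fastforce
    with Nil Cons have "r1 = None" "c1' = [x]" by (auto simp: column_insert_Cons split: option.splits)
    with bump_length[OF b] Nil Cons show ?thesis by auto
  qed (use Nil in auto)
next
  case (Cons c P)
  obtain c' r where b: "bump x c = (c', r)" by fastforce
  show ?case
  proof (cases P1)
    case Nil
    with Cons b have "r = None" "c' = [x1]" by (auto simp: column_insert_Cons split: option.splits)
    with bump_length[OF b] Cons show ?thesis by auto
  next
    case P1: (Cons c1 P1')
    obtain c1' r1 where b1: "bump x1 c1 = (c1', r1)" by fastforce
    have eq: "c1' = c'" "r1 = r \<and> P1' = P"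
    proof -
      show "c1' = c'" using Cons.prems b b1 P1 by (auto simp: column_insert_Cons split: option.splits)
      show "r1 = r \<and> P1' = P"
      proof (cases r)
        case None
        then show ?thesis using Cons.prems b b1 P1 by (auto simp: column_insert_Cons split: option.splits)
      next
        case (Some y)
        then obtain y1 where "r1 = Some y1" "column_insert y P = column_insert y1 P1'"
          using Cons.prems b b1 P1
          by (auto simp: column_insert_Cons prod_eq_iff split: option.splits)
        then show ?thesis using Cons.IH[of P1' y y1] Cons.prems Some P1 by auto
      qed
    qed
    then show ?thesis using bump_inj[of c c1 x c' r x1] b b1 Cons.prems P1 by auto
  qed
qed

section \<open>Insertion and recording tableaux of words\<close>

lemma P_tab_Nil [simp]: "P_tab [] = []" and Q_tab_Nil [simp]: "Q_tab [] = []"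
  by (simp_all add: P_tab_def Q_tab_def PQ_def)

lemma PQ_snoc: "PQ (w @ [x]) = insert_record (Suc (length w), x) (PQ w)"
proof -
  have "[1..<length (w @ [x]) + 1] = [1..<length w + 1] @ [Suc (length w)]" by simp
  then show ?thesis unfolding PQ_def by (simp del: upt_Suc)
qed

lemma P_tab_snoc: "P_tab (w @ [x]) = fst (column_insert x (P_tab w))"
  and Q_tab_snoc:
    "Q_tab (w @ [x]) = add_box (snd (column_insert x (P_tab w))) (Suc (length w)) (Q_tab w)"
  by (simp_all add: P_tab_def Q_tab_def PQ_snoc insert_record_def split_beta)

lemma columns_P_tab: "columns (P_tab w)"
  by (induction w rule: rev_induct) (auto simp: P_tab_snoc columns_column_insert)

lemma mset_P_tab: "mset (column_word (P_tab w)) = mset w"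
  by (induction w rule: rev_induct) (auto simp: P_tab_snoc mset_column_insert)

text \<open>Whether a word has highest or lowest weight can therefore be read off its insertion
  tableau.\<close>

lemma clo_opn_P_tab: "clo i (column_word (P_tab w)) = clo i w \<and> opn i (column_word (P_tab w)) = opn i w"
  by (induction w rule: rev_induct) (auto simp: P_tab_snoc clo_opn_column_insert[OF columns_P_tab])

lemma shape_Q_tab: "map length (Q_tab w) = map length (P_tab w)"
proof (induction w rule: rev_induct)
  case (snoc x w)
  then have "length (Q_tab w) = length (P_tab w)" using map_eq_imp_length_eq by blast
  moreover from snoc this have "length (Q_tab w ! m) = length (P_tab w ! m)" if "m < length (P_tab w)" for m
    using that by (metis nth_map)
  ultimately show ?case using snoc column_insert_shape[of x "P_tab w"]
    by (auto simp: P_tab_snoc Q_tab_snoc grow_def add_box_def map_update)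
qed simp

text \<open>Induction on the last letter, strengthened by the claim that the insertion tableaux are
  related by the same lowering. The prefixes are either equal or again related by a lowering, and
  \<open>lowers_column_insert\<close> covers both cases.\<close>

lemma lowers_imp_Q_tab_eq:
  assumes "lowers i w w'"
  shows "Q_tab w = Q_tab w'"
proof -
  have "length w' = length w" using assms lowers_length by blast
  then have "length w = length w'" by simp
  then have "Q_tab w = Q_tab w' \<and> lowers i (column_word (P_tab w)) (column_word (P_tab w'))"
    using assms
  proof (induction w w' rule: rev_induct2)
    case (4 x w x' w')
    then have len: "length w' = length w" by simp
    have "Q_tab w = Q_tab w' \<and> lowers i (column_word (P_tab w) @ [x]) (column_word (P_tab w') @ [x'])"
    proof (cases "w = w'")
      case True
      with 4 have "lowers i [x] [x'] \<and> opn i w \<le> clo i [x]" 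
        by (auto simp: lowers_append lowers_irrefl simp del: clo.simps)
      with True show ?thesis by (simp add: lowers_append clo_opn_P_tab del: clo.simps)
    next
      case False
      with 4 have *: "lowers i w w'" "x' = x" "clo i [x] < opn i w"
        by (auto simp: lowers_append[OF len])
      with 4 have IH: "Q_tab w = Q_tab w'" "lowers i (column_word (P_tab w)) (column_word (P_tab w'))"
        by auto
      with * show ?thesis
        by (simp add: lowers_append[OF lowers_length[OF IH(2)]] clo_opn_P_tab)
    qed
    moreover from this have "map length (P_tab w) = map length (P_tab w')" using shape_Q_tab by metis
    ultimately show ?case
      using lowers_column_insert[OF columns_P_tab columns_P_tab, of w w' i x x'] len
      by (simp add: P_tab_snoc Q_tab_snoc)
  qed (auto simp: lowers_def)
  then show ?thesis by blast
qed

lemma Q_tab_bounded: "c \<in> set (Q_tab w) \<Longrightarrow> k \<in> set c \<Longrightarrow> k \<le> length w"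
proof (induction w arbitrary: c rule: rev_induct)
  case (snoc x w)
  have "k \<in> \<Union> (set ` set (add_box m (Suc (length w)) Q)) \<Longrightarrow>
      k = Suc (length w) \<or> k \<in> \<Union> (set ` set Q)" for m Q
    by (auto simp: add_box_def dest!: set_update_subset_insert[THEN subsetD] split: if_splits)
  from this[of _ "Q_tab w"] snoc show ?case by (force simp: Q_tab_snoc)
qed simp

text \<open>The label \<open>k\<close> is new, so it marks the column \<open>m\<close>; deleting it,
  together with its column if that becomes empty, restores \<open>Q\<close>.\<close>

lemma add_box_inj:
  assumes "add_box m k Q = add_box m' k Q'" "m \<le> length Q" "m' \<le> length Q'"
    and "\<forall>c\<in>set Q. k \<notin> set c \<and> c \<noteq> []" "\<forall>c\<in>set Q'. k \<notin> set c \<and> c \<noteq> []"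
  shows "m = m' \<and> Q = Q'"
proof -
  have box: "j < length (add_box m k Q) \<and> k \<in> set (add_box m k Q ! j) \<longleftrightarrow> j = m"
    if "m \<le> length Q" "\<forall>c\<in>set Q. k \<notin> set c \<and> c \<noteq> []" for m Q j
    using that by (auto simp: add_box_def nth_append nth_list_update)
  have m: "m = m'" using box[of m Q m] box[of m' Q' m] assms by simp
  have rem: "Q = (let R = add_box m k Q; c = butlast (R ! m)
      in if c = [] then take m R else R[m := c])" 
    if "m \<le> length Q" "\<forall>c\<in>set Q. k \<notin> set c \<and> c \<noteq> []" for m Q
    using that by (auto simp: add_box_def Let_def)
  have "Q = Q'" using rem[of m Q] rem[of m' Q'] assms m by metis
  with m show ?thesis by blast
qed

text \<open>The injective half of the Robinson-Schensted correspondence: the largest label of the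
  recording tableau locates the last insertion, which can then be undone.\<close>

lemma PQ_tab_inj:
  assumes "P_tab w = P_tab w'" "Q_tab w = Q_tab w'"
  shows "w = w'"
proof -
  have "length w = length w'" using mset_P_tab[of w] mset_P_tab[of w'] assms by (metis size_mset)
  then show ?thesis using assms
  proof (induction w w' rule: rev_induct2)
    case (4 x w x' w')
    have ne: "\<forall>c\<in>set (Q_tab u). Suc (length u) \<notin> set c \<and> c \<noteq> []" for u
    proof
      fix c assume c: "c \<in> set (Q_tab u)"
      then have "length c \<in> set (map length (P_tab u))" by (metis image_eqI list.set_map shape_Q_tab)
      then have "length c \<noteq> 0" using columns_P_tab[of u] by (auto simp: columns_def)
      with Q_tab_bounded[OF c] show "Suc (length u) \<notin> set c \<and> c \<noteq> []" by fastforce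
    qed
    have le: "snd (column_insert y (P_tab u)) \<le> length (Q_tab u)" for u y
      using column_insert_shape[of y "P_tab u"] shape_Q_tab[of u] by (metis length_map)
    have len: "length w = length w'" using 4 by simp
    have "snd (column_insert x (P_tab w)) = snd (column_insert x' (P_tab w')) \<and> Q_tab w = Q_tab w'"
      using 4 by (intro add_box_inj[where k = "Suc (length w)"]) (auto simp: Q_tab_snoc le ne len ne[of w, unfolded len])
    moreover have "fst (column_insert x (P_tab w)) = fst (column_insert x' (P_tab w'))"
      using 4 by (simp add: P_tab_snoc)
    ultimately have *: "x' = x \<and> P_tab w' = P_tab w" "Q_tab w = Q_tab w'"
      using column_insert_inj[OF columns_P_tab columns_P_tab, of x w x' w'] by (auto simp: prod_eq_iff)
    then show ?case using 4(1)[OF len] by simp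
  qed auto
qed


section \<open>Insertion tableaux of extremal weight\<close>

text \<open>The condition for \<open>c\<close> to stand to the left of \<open>c'\<close> in a
  semistandard tableau of straight shape.\<close>

definition row_le :: "nat list \<Rightarrow> nat list \<Rightarrow> bool" where
  "row_le c c' \<longleftrightarrow> length c' \<le> length c \<and> (\<forall>t<length c'. c ! t \<le> c' ! t)"

lemma transp_row_le: "transp row_le"
proof (rule transpI)
  fix a b c assume "row_le a b" "row_le b c"
  then show "row_le a c" unfolding row_le_def by (meson order_trans order_less_le_trans)
qed

text \<open>In the row that \<open>y\<close> leaves, \<open>d\<close> has no entry or one that is
  \<open>\<ge> y\<close>, so \<open>y\<close> enters \<open>d\<close> in this row or below. Up to
  this row the entries of \<open>c'\<close> are at most \<open>x \<le> y\<close>, and nowhere do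
  they exceed those of \<open>c\<close>.\<close>

lemma row_le_bump:
  assumes c: "sorted_wrt (<) c" and d: "sorted_wrt (<) d" and cd: "row_le c d"
    and b: "bump x c = (c', Some y)" and b1: "bump y d = (d', r)"
  shows "row_le c' d'"
proof -
  obtain l h where lh: "c = l @ y # h" "\<forall>z\<in>set l. z < x" "x \<le> y" "c' = l @ x # h"
    using b by (cases c x rule: bump_cases) auto
  have c': "sorted_wrt (<) c'" using bump_sorted[OF c b] .
  have le: "length d \<le> length c" "\<And>t. t < length d \<Longrightarrow> c ! t \<le> d ! t" using cd by (auto simp: row_le_def)
  have ly: "c ! length l = y" "c' ! length l = x" "length c' = length c" "length l < length c" using lh by auto
  have c'c: "c' ! t \<le> c ! t" if "t < length c" for t
    using lh that by (auto simp: nth_append nth_Cons')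
  have c'y: "c' ! t \<le> y" if "t \<le> length l" for t
  proof -
    have "c' ! t \<le> c' ! length l" using that c' ly by (cases "t = length l") (auto simp: sorted_wrt_iff_nth_less intro: less_imp_le)
    then show ?thesis using ly lh by simp
  qed
  show ?thesis
  proof (cases d y rule: bump_cases)
    case None
    then have d': "d' = d @ [y]" using b1 by simp
    have "length d \<le> length l"
    proof (rule ccontr)
      assume "\<not> length d \<le> length l"
      then have "y \<le> d ! length l" "d ! length l \<in> set d" using le(2)[of "length l"] ly by auto
      with None show False by force
    qed
    moreover have "c' ! t \<le> d' ! t" if "t < Suc (length d)" for t
    proof (cases "t = length d")
      case False
      then have "t < length d" using that by simp
      then have "c' ! t \<le> c ! t" "c ! t \<le> d ! t" using c'c le by auto
      then show ?thesis using d' \<open>t < length d\<close> by (simp add: nth_append)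
    qed (use calculation c'y d' in simp)
    ultimately show ?thesis unfolding row_le_def using d' ly by simp
  next
    case (Some l1 z h1)
    then have d': "d' = l1 @ y # h1" using b1 by simp
    have "length l1 \<le> length l"
    proof (rule ccontr)
      assume "\<not> length l1 \<le> length l"
      then have "d ! length l \<in> set l1" "length l < length d" using Some(1) by (auto simp: nth_append)
      then have "y \<le> d ! length l" "d ! length l < y" using le(2)[of "length l"] ly Some by auto
      then show False by simp
    qed
    moreover have "d' ! t = d ! t" if "t \<noteq> length l1" for t
      using that d' Some(1) by (auto simp: nth_append nth_Cons')
    moreover have "d' ! length l1 = y" "length d' = length d" using d' Some(1) by auto
    moreover have "c' ! t \<le> d' ! t" if "t < length d" for t
    proof (cases "t = length l1")
      case False
      have "c' ! t \<le> c ! t" "c ! t \<le> d ! t" using c'c le that by auto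
      then show ?thesis using calculation(2)[OF False] by simp
    qed (use calculation c'y in simp)
    ultimately show ?thesis unfolding row_le_def using le ly by simp
  qed
qed

lemma rows_column_insert:
  assumes "columns P" "sorted_wrt row_le P"
  shows "sorted_wrt row_le (fst (column_insert x P))"
  using assms
proof (induction P arbitrary: x)
  case (Cons c P)
  obtain c' r where b: "bump x c = (c', r)" by fastforce
  show ?case
  proof (cases r)
    case None
    then have "c' = c @ [x]" using b by (cases c x rule: bump_cases) auto
    then have "row_le c e \<Longrightarrow> row_le c' e" for e by (auto simp: row_le_def nth_append)
    then show ?thesis using Cons.prems b None by (auto simp: column_insert_Cons)
  next
    case (Some y)
    let ?P = "fst (column_insert y P)"
    have IH: "sorted_wrt row_le ?P" using Cons by auto
    have "row_le c' (hd ?P)"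
    proof (cases P)
      case Nil
      obtain l h where lh: "c = l @ y # h" "\<forall>z\<in>set l. z < x" "x \<le> y" "c' = l @ x # h"
        using b Some by (cases c x rule: bump_cases) auto
      then have "c' ! 0 \<le> y" by (cases l) auto
      then show ?thesis using Nil lh by (auto simp: row_le_def)
    next
      case P: (Cons e P')
      obtain e' s where b1: "bump y e = (e', s)" by fastforce
      then have "hd ?P = e'" using P by (simp add: column_insert_Cons split: option.splits)
      then show ?thesis using row_le_bump[OF _ _ _ b[unfolded Some] b1] Cons.prems P by simp
    qed
    moreover have "?P \<noteq> []" by (cases P) (auto simp: column_insert_Cons split: option.splits)
    ultimately have "sorted_wrt row_le (c' # ?P)"
      using IH by (cases ?P) (simp_all add: sorted_wrt2[OF transp_row_le] del: sorted_wrt.simps)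
    then show ?thesis using b Some by (simp add: column_insert_Cons)
  qed
qed simp

lemma rows_P_tab: "sorted_wrt row_le (P_tab w)"
  by (induction w rule: rev_induct) (auto simp: P_tab_snoc rows_column_insert columns_P_tab)

text \<open>\<open>hs\<close> lists the column heights. This is the Yamanouchi tableau, whose row
  \<open>t\<close> consists of \<open>t\<close>'s; \<open>top_tab\<close> is its lowest weight
  counterpart, each column holding the largest letters of \<open>[d]\<close>.\<close>

definition bottom_tab :: "nat list \<Rightarrow> nat list list" where
  "bottom_tab hs = map (\<lambda>h. [1..<h + 1]) hs"

definition top_tab :: "nat \<Rightarrow> nat list \<Rightarrow> nat list list" where
  "top_tab d hs = map (\<lambda>h. [d + 1 - h..<d + 1]) hs"

lemma bottom_tab_column: "P = bottom_tab hs \<Longrightarrow> e \<in> set P \<Longrightarrow> e = [1..<length e + 1]"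
  by (auto simp: bottom_tab_def simp del: upt_Suc)

lemma top_tab_column:
  "P = top_tab d hs \<Longrightarrow> e \<in> set P \<Longrightarrow> length e \<le> d \<Longrightarrow> e = [d + 1 - length e..<d + 1]"
  by (auto simp: top_tab_def simp del: upt_Suc)

lemma column_word_append [simp]: "column_word (P @ Q) = column_word Q @ column_word P"
  by (simp add: column_word_def)

lemma clo_prefix: "clo i (u @ v) = 0 \<Longrightarrow> clo i u = 0"
  by simp

lemma opn_suffix: "opn i (u @ v) = 0 \<Longrightarrow> opn i v = 0"
  by simp

lemma count_le_of_clo: "clo i w = 0 \<Longrightarrow> count_list w (Suc i) \<le> count_list w i"
  using count_clo_opn[of w i] by simp

lemma count_le_of_opn: "opn i w = 0 \<Longrightarrow> count_list w i \<le> count_list w (Suc i)"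
  using count_clo_opn[of w i] by simp

lemma count_list_distinct: "distinct xs \<Longrightarrow> count_list xs x = (if x \<in> set xs then 1 else 0)"
  by (induction xs) auto

lemma count_column_word: "count_list (column_word P) x = (\<Sum>c\<leftarrow>P. count_list c x)"
  by (induction P) auto

lemma sorted_wrt_less_ge_idx:
  "sorted_wrt (<) (c :: nat list) \<Longrightarrow> 0 \<notin> set c \<Longrightarrow> t < length c \<Longrightarrow> t < c ! t"
proof (induction t)
  case 0
  then show ?case by (metis gr0I nth_mem)
next
  case (Suc t)
  then have "t < c ! t" "c ! t < c ! Suc t" by (auto simp: sorted_wrt_iff_nth_less)
  then show ?case by simp
qed

text \<open>Let \<open>x = Suc i\<close> be the lowest entry of \<open>c\<close> that is too large.
  The prefix of the word ending in \<open>x\<close> contains no \<open>i\<close>: the entries below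
  are too small, and a column of \<open>P\<close> containing \<open>i\<close> would have in the row
  of \<open>x\<close> an entry smaller than \<open>x\<close>. So this \<open>x\<close> is
  unmatched.\<close>

lemma bottom_column:
  assumes P: "columns (c # P)" "sorted_wrt row_le (c # P)" and z: "0 \<notin> set c"
    and clo: "\<And>i. 1 \<le> i \<Longrightarrow> clo i (column_word (c # P)) = 0"
    and IH: "P = bottom_tab (map length P)"
  shows "c = [1..<length c + 1]"
proof -
  have s: "sorted_wrt (<) c" using P by simp
  have "c ! t = t + 1" if "t < length c" for t
    using that
  proof (induction t rule: less_induct)
    case (less t)
    show ?case
    proof (rule ccontr)
      assume ne: "c ! t \<noteq> t + 1"
      define x where "x = c ! t"
      have x: "t + 1 < x" using sorted_wrt_less_ge_idx[OF s z less.prems] ne by (simp add: x_def)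
      then obtain i where i: "x = Suc i" "t < i" by (cases x) auto
      have "c = take t c @ x # drop (Suc t) c" using less.prems by (simp add: x_def id_take_nth_drop)
      then have "clo i (column_word P @ take t c @ [x]) = 0"
        using clo[of i] clo_prefix[of i "column_word P @ take t c @ [x]" "drop (Suc t) c"] i
        by (metis (no_types, lifting) append.assoc append_Cons append_Nil column_word_simps(2) gr_implies_not0 less_one not_less)
      then have le: "count_list (column_word P @ take t c @ [x]) (Suc i) \<le> count_list (column_word P @ take t c @ [x]) i"
        by (rule count_le_of_clo)
      have "i \<notin> set (take t c)"
        using less i by (auto simp: in_set_conv_nth)
      moreover have "i \<notin> set (column_word P)"
      proof
        assume "i \<in> set (column_word P)"
        then obtain e where e: "e \<in> set P" "i \<in> set e" by (auto simp: column_word_def)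
        then have e2: "e = [1..<length e + 1]" using bottom_tab_column[OF IH] by blast
        then have "i \<le> length e" using e(2) by (metis Suc_eq_plus1 atLeastLessThan_iff less_Suc_eq_le set_upt)
        then have "t < length e" using i by simp
        moreover have "row_le c e" using P e by auto
        ultimately have "x \<le> e ! t" by (auto simp: row_le_def x_def)
        moreover have "e ! t = t + 1" using \<open>t < length e\<close> by (subst e2) (simp del: upt_Suc)
        ultimately show False using x by simp
      qed
      ultimately have "count_list (column_word P @ take t c @ [x]) i = 0"
        using i by (simp add: count_notin)
      with le i show False by simp
    qed
  qed
  then show ?thesis by (intro nth_equalityI) (auto simp del: upt_Suc)
qed

text \<open>Highest weight passes to prefixes of the column word, that is, to the columns further
  right; hence the first column is split off.\<close>

lemma bottom_tab_unique:
  assumes "columns P" "sorted_wrt row_le P" "0 \<notin> set (column_word P)"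
    and "\<And>i. 1 \<le> i \<Longrightarrow> clo i (column_word P) = 0"
  shows "P = bottom_tab (map length P)"
  using assms
proof (induction P)
  case (Cons c P)
  have "P = bottom_tab (map length P)"
  proof (rule Cons.IH)
    show "clo i (column_word P) = 0" if "1 \<le> i" for i
      using Cons.prems(4)[OF that] clo_prefix[of i "column_word P" c] by simp
  qed (use Cons.prems in auto)
  moreover from this have "c = [1..<length c + 1]"
    using bottom_column[of c P] Cons.prems by auto
  ultimately show ?case by (simp add: bottom_tab_def)
qed (simp add: bottom_tab_def)

text \<open>Going down from the top of \<open>c\<close>, let \<open>x\<close> be the first entry
  below its expected value \<open>d - t\<close>. In the suffix starting at \<open>x\<close>, the
  entries above it do not include \<open>x + 1\<close>, and every column of \<open>P\<close> reaches
  down to \<open>x\<close>, so it has at least as many \<open>x\<close> as \<open>x + 1\<close>. The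
  leading \<open>x\<close> is in excess, contrary to lowest weight.\<close>

lemma top_column:
  assumes P: "columns (P @ [c])" "sorted_wrt row_le (P @ [c])"
    and z: "set c \<subseteq> {1..d}" "\<forall>e\<in>set P. length e \<le> d"
    and opn: "\<And>i. 1 \<le> i \<Longrightarrow> i < d \<Longrightarrow> opn i (column_word (P @ [c])) = 0"
    and IH: "P = top_tab d (map length P)"
  shows "c = [d + 1 - length c..<d + 1]"
proof -
  have s: "sorted_wrt (<) c" and row: "\<And>e. e \<in> set P \<Longrightarrow> row_le e c"
    using P by (auto simp: columns_def sorted_wrt_append)
  have P_col: "e = [d + 1 - length e..<d + 1]" if "e \<in> set P" for e
    using top_tab_column[OF IH that] z(2) that by blast
  have top: "c ! (length c - 1 - t) = d - t" if "t < length c" for t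
    using that
  proof (induction t rule: less_induct)
    case (less t)
    define p where "p = length c - 1 - t"
    define x where "x = c ! p"
    have p: "p < length c" "length c - p = Suc t" using less.prems by (auto simp: p_def)
    have above: "c ! q = d - (length c - 1 - q)" if "p < q" "q < length c" for q
    proof -
      have "length c - 1 - q < t" "length c - 1 - (length c - 1 - q) = q" using that p_def by auto
      then show ?thesis using less.IH[of "length c - 1 - q"] less.prems by simp
    qed
    have x1: "x \<in> set c" "1 \<le> x" "x \<le> d" using z(1) nth_mem[OF p(1)] by (auto simp: x_def)
    have xt: "x \<le> d - t"
    proof (cases t)
      case (Suc t')
      then have "Suc p < length c" "length c - 1 - Suc p = t'" using p by auto
      then have "c ! Suc p = d - t'" "x < c ! Suc p"
        using above[of "Suc p"] sorted_wrt_nth_less[OF s, of p "Suc p"] by (auto simp: x_def)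
      then show ?thesis using Suc by simp
    qed (use x1 in simp)
    show ?case
    proof (rule ccontr)
      assume "c ! (length c - 1 - t) \<noteq> d - t"
      then have xlt: "x < d - t" using xt by (simp add: x_def p_def)
      let ?r = "drop (Suc p) c"
      have "c = take p c @ x # ?r" using p by (simp add: x_def id_take_nth_drop)
      then have "c @ column_word P = take p c @ (x # ?r @ column_word P)"
        by (metis append.assoc append_Cons)
      moreover have "opn x (c @ column_word P) = 0"
        using opn[of x] x1 xlt by (simp del: opn_append)
      ultimately have "opn x (take p c @ (x # ?r @ column_word P)) = 0" by (simp only:)
      then have "opn x (x # ?r @ column_word P) = 0" by (rule opn_suffix)
      then have le: "count_list (x # ?r @ column_word P) x \<le> count_list (x # ?r @ column_word P) (Suc x)"
        by (rule count_le_of_opn)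
      have "Suc x \<notin> set ?r"
      proof
        assume "Suc x \<in> set ?r"
        then obtain k where "k < length c - Suc p" "Suc x = c ! (Suc p + k)" by (auto simp: in_set_conv_nth)
        then have "Suc x = d - (length c - 1 - (Suc p + k))" "Suc p + k < length c" using above[of "Suc p + k"] by auto
        then show False using xlt p p_def by simp
      qed
      moreover have "count_list (column_word P) (Suc x) \<le> count_list (column_word P) x"
        unfolding count_column_word
      proof (rule sum_list_mono)
        fix e assume e: "e \<in> set P"
        have "p < length e" "e ! p \<le> x" using row[OF e] p by (auto simp: row_le_def x_def)
        moreover have "e ! p = d + 1 - length e + p" using \<open>p < length e\<close> bspec[OF z(2) e] by (subst P_col[OF e]) (simp del: upt_Suc)
        ultimately have "d + 1 - length e \<le> x" by simp
        then have "x \<in> set e" using x1 by (subst P_col[OF e]) (simp del: upt_Suc)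
        then have "1 \<le> count_list e x" by (metis count_list_0_iff less_one not_less)
        moreover have "distinct e" using P_col[OF e] by (metis distinct_upt)
        then have "count_list e (Suc x) \<le> 1" by (simp add: count_list_distinct)
        ultimately show "count_list e (Suc x) \<le> count_list e x" by simp
      qed
      ultimately show False using le by (simp add: count_notin)
    qed
  qed
  have len: "length c \<le> d"
    using card_mono[OF _ z(1)] distinct_card[of c] s by (simp add: strict_sorted_iff)
  show ?thesis
  proof (intro nth_equalityI)
    fix q assume q: "q < length c"
    with top[of "length c - 1 - q"] len show "c ! q = [d + 1 - length c..<d + 1] ! q"
      by (simp del: upt_Suc)
  qed (use len in \<open>simp del: upt_Suc\<close>)
qed

text \<open>Lowest weight passes to suffixes, the columns further left; hence the last column is
  split off.\<close>

lemma top_tab_unique: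
  assumes "columns P" "sorted_wrt row_le P" "set (column_word P) \<subseteq> {1..d}"
    and "\<And>i. 1 \<le> i \<Longrightarrow> i < d \<Longrightarrow> opn i (column_word P) = 0"
  shows "P = top_tab d (map length P)"
  using assms
proof (induction P rule: rev_induct)
  case (snoc c P)
  have "P = top_tab d (map length P)"
  proof (rule snoc.IH)
    show "opn i (column_word P) = 0" if "1 \<le> i" "i < d" for i
      using snoc.prems(4)[OF that] opn_suffix[of i c "column_word P"] by simp
  qed (use snoc.prems in \<open>auto simp: columns_def sorted_wrt_append\<close>)
  moreover have "length e \<le> d" if "e \<in> set P" for e
  proof -
    have "set e \<subseteq> {1..d}" "distinct e" 
      using that snoc.prems by (auto simp: columns_def column_word_def strict_sorted_iff)
    then show ?thesis using card_mono[of "{1..d}" "set e"] distinct_card[of e] by simp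
  qed
  ultimately have "c = [d + 1 - length c..<d + 1]"
    using top_column[of P c d] snoc.prems by auto
  with \<open>P = top_tab d (map length P)\<close> show ?case by (simp add: top_tab_def)
qed (simp add: top_tab_def)


section \<open>Dual words and chains of lowering steps\<close>

definition dual_word :: "nat \<Rightarrow> nat list \<Rightarrow> nat list" where
  "dual_word d w = map (\<lambda>k. d + 1 - k) (rev w)"

lemma dual_word_append [simp]: "dual_word d (u @ v) = dual_word d v @ dual_word d u"
  and dual_word_Cons [simp]: "dual_word d (x # w) = dual_word d w @ [d + 1 - x]"
  and dual_word_Nil [simp]: "dual_word d [] = []"
  by (simp_all add: dual_word_def)

lemma set_dual_word: "set w \<subseteq> {1..d} \<Longrightarrow> set (dual_word d w) \<subseteq> {1..d}"
  by (induction w) auto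

text \<open>\<open>i + 1\<close> becomes \<open>d - i\<close> and \<open>i\<close> becomes
  \<open>d - i + 1\<close>, so the bracketing is reflected and the two kinds of brackets are
  exchanged.\<close>

lemma clo_opn_dual_word:
  assumes "set w \<subseteq> {1..d}" "1 \<le> i" "i < d"
  shows "clo (d - i) (dual_word d w) = opn i w \<and> opn (d - i) (dual_word d w) = clo i w"
  using assms(1)
proof (induction w)
  case (Cons x w)
  then have "d + 1 - x = d - i \<longleftrightarrow> x = Suc i" "d + 1 - x = Suc (d - i) \<longleftrightarrow> x = i"
    using assms(2,3) by auto
  with Cons show ?case by auto
qed simp

lemma count_dual_word:
  assumes "set w \<subseteq> {1..d}" "1 \<le> i" "i \<le> d"
  shows "count_list (dual_word d w) (d + 1 - i) = count_list w i"
  using assms(1)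
proof (induction w)
  case (Cons x w)
  then have "d + 1 - x = d + 1 - i \<longleftrightarrow> x = i" using assms(2,3) by auto
  with Cons show ?case by auto
qed simp

definition step :: "nat \<Rightarrow> nat list \<Rightarrow> nat list \<Rightarrow> bool" where
  "step d u v \<longleftrightarrow> (\<exists>i. 1 \<le> i \<and> i < d \<and> lowers i u v)"

lemma step_set: "step d u v \<Longrightarrow> set u \<subseteq> {1..d} \<Longrightarrow> set v \<subseteq> {1..d}"
  by (auto simp: step_def lowers_def subset_iff)

lemma step_sum_list: "step d u v \<Longrightarrow> sum_list v = Suc (sum_list u)"
  by (auto simp: step_def lowers_def)

lemma step_length: "step d u v \<Longrightarrow> length v = length u"
  by (auto simp: step_def lowers_def)

lemma steps_set: "(step d)\<^sup>*\<^sup>* u v \<Longrightarrow> set u \<subseteq> {1..d} \<Longrightarrow> set v \<subseteq> {1..d}"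
  by (induction rule: rtranclp_induct) (blast dest: step_set)+

lemma steps_Q_tab: "(step d)\<^sup>*\<^sup>* u v \<Longrightarrow> Q_tab u = Q_tab v"
  by (induction rule: rtranclp_induct) (auto simp: step_def dest: lowers_imp_Q_tab_eq)

lemma step_dual_word:
  assumes "step d u v" "set u \<subseteq> {1..d}"
  shows "step d (dual_word d v) (dual_word d u)"
proof -
  from assms(1) obtain i a b where i: "1 \<le> i" "i < d"
    and ab: "u = a @ i # b" "v = a @ Suc i # b" "opn i a = 0" "clo i b = 0"
    unfolding step_def lowers_def by blast
  have s: "set a \<subseteq> {1..d}" "set b \<subseteq> {1..d}" using assms(2) ab by auto
  have "lowers (d - i) (dual_word d b @ (d - i) # dual_word d a) (dual_word d b @ Suc (d - i) # dual_word d a)"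
    using clo_opn_dual_word[OF s(1) i] clo_opn_dual_word[OF s(2) i] ab by (intro lowersI) auto
  moreover have "d + 1 - i = Suc (d - i)" "d + 1 - Suc i = d - i" using i by auto
  ultimately have "lowers (d - i) (dual_word d v) (dual_word d u)" using ab by simp
  then show ?thesis unfolding step_def using i by (intro exI[of _ "d - i"]) auto
qed

lemma steps_dual_word:
  "(step d)\<^sup>*\<^sup>* u v \<Longrightarrow> set u \<subseteq> {1..d} \<Longrightarrow> (step d)\<^sup>*\<^sup>* (dual_word d v) (dual_word d u)"
proof (induction rule: rtranclp_induct)
  case (step v v')
  then have "step d (dual_word d v') (dual_word d v)" using step_dual_word steps_set by blast
  with step show ?case by (meson converse_rtranclp_into_rtranclp)
qed simp

definition lowest :: "nat \<Rightarrow> nat list \<Rightarrow> bool" where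
  "lowest d w \<longleftrightarrow> (\<forall>i. 1 \<le> i \<and> i < d \<longrightarrow> opn i w = 0)"

lemma lowest_or_step: "lowest d w \<or> (\<exists>v. step d w v)"
  unfolding lowest_def step_def using ex_lowers by blast

lemma yamanouchi_dual_word:
  assumes "set w \<subseteq> {1..d}"
  shows "yamanouchi (dual_word d w) \<longleftrightarrow> lowest d w"
proof -
  \<comment> \<open>Letters above \<open>d\<close> do not occur, so only the conditions with
    \<open>i < d\<close> carry information.\<close>
  have "clo i (dual_word d w) = 0" if "d \<le> i" for i
    using set_dual_word[OF assms] that by (intro clo_eq_0) auto
  moreover have "clo i (dual_word d w) = opn (d - i) w" if "1 \<le> i" "i < d" for i
    using clo_opn_dual_word[OF assms, of "d - i"] that by auto
  ultimately have "yamanouchi (dual_word d w) \<longleftrightarrow> (\<forall>i. 1 \<le> i \<and> i < d \<longrightarrow> opn (d - i) w = 0)"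
    unfolding yamanouchi_iff_clo by (metis not_less)
  also have "\<dots> \<longleftrightarrow> lowest d w"
  proof -
    have "opn i w = 0" if "\<forall>i. 1 \<le> i \<and> i < d \<longrightarrow> opn (d - i) w = 0" "1 \<le> i" "i < d" for i
      using that(1)[rule_format, of "d - i"] that(2,3) by simp
    then show ?thesis unfolding lowest_def by auto
  qed
  finally show ?thesis .
qed

lemma dual_word_dual_word: "set w \<subseteq> {1..d} \<Longrightarrow> dual_word d (dual_word d w) = w"
  by (induction w) auto

section \<open>Content and shape of extremal words\<close>

abbreviation shape :: "nat list \<Rightarrow> nat list" where
  "shape w \<equiv> map length (P_tab w)"

lemma set_P_tab: "set (column_word (P_tab w)) = set w"
  by (metis mset_P_tab set_mset_mset)

lemma P_tab_yamanouchi: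
  assumes "yamanouchi w" "0 \<notin> set w"
  shows "P_tab w = bottom_tab (shape w)"
  using assms by (intro bottom_tab_unique columns_P_tab rows_P_tab)
    (auto simp: set_P_tab clo_opn_P_tab yamanouchi_iff_clo)

lemma P_tab_lowest:
  assumes "lowest d w" "set w \<subseteq> {1..d}"
  shows "P_tab w = top_tab d (shape w)"
  using assms by (intro top_tab_unique columns_P_tab rows_P_tab)
    (auto simp: set_P_tab clo_opn_P_tab lowest_def)

lemma sum_list_if_length: "(\<Sum>x\<leftarrow>xs. if Q x then 1 else 0) = length (filter Q xs)"
  by (induction xs) auto

lemma count_bottom_tab:
  "1 \<le> i \<Longrightarrow> count_list (column_word (bottom_tab hs)) i = length (filter (\<lambda>h. i \<le> h) hs)"
  by (simp add: count_column_word bottom_tab_def o_def count_list_distinct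
      less_Suc_eq_le flip: sum_list_if_length del: upt_Suc)

lemma count_top_tab:
  assumes "1 \<le> i" "i \<le> d" "\<forall>h\<in>set hs. h \<le> d"
  shows "count_list (column_word (top_tab d hs)) (d + 1 - i) = length (filter (\<lambda>h. i \<le> h) hs)"
proof -
  have "d + 1 - i \<in> set [d + 1 - h..<d + 1] \<longleftrightarrow> i \<le> h" if "h \<in> set hs" for h
    using assms that by auto
  then have "(\<Sum>h\<leftarrow>hs. count_list [d + 1 - h..<d + 1] (d + 1 - i)) = (\<Sum>h\<leftarrow>hs. if i \<le> h then 1 else 0)"
    by (intro arg_cong[where f = sum_list] map_cong) (simp_all add: count_list_distinct del: upt_Suc)
  then show ?thesis
    by (simp add: count_column_word top_tab_def o_def sum_list_if_length del: upt_Suc)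
qed

lemma count_list_P_tab: "count_list (column_word (P_tab w)) k = count_list w k"
  by (metis count_mset mset_P_tab)

lemma shape_bounds:
  assumes "set w \<subseteq> {1..d}"
  shows "h \<in> set (shape w) \<Longrightarrow> 1 \<le> h \<and> h \<le> d"
proof -
  assume "h \<in> set (shape w)"
  then obtain c where c: "c \<in> set (P_tab w)" "h = length c" by auto
  then have s: "sorted_wrt (<) c" "c \<noteq> []" using columns_P_tab by (auto simp: columns_def)
  have "set c \<subseteq> set (column_word (P_tab w))" using c by (auto simp: column_word_def)
  then have "set c \<subseteq> {1..d}" using assms set_P_tab by blast
  then have "card (set c) \<le> d" using card_mono[of "{1..d}" "set c"] by simp
  then show ?thesis using s c distinct_card[of c] by (simp add: strict_sorted_iff Suc_le_eq)
qed

lemma shape_decreasing: "sorted_wrt (\<ge>) (shape w)"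
  using rows_P_tab[of w] by (auto simp: sorted_wrt_map row_le_def intro: sorted_wrt_mono_rel[rotated])

text \<open>A partition is determined by its conjugate: the multiplicity of \<open>i\<close> is the
  difference between the numbers of parts \<open>\<ge> i\<close> and
  \<open>\<ge> Suc i\<close>.\<close>

lemma decreasing_lists_eqI:
  fixes hs hs' :: "nat list"
  assumes "sorted_wrt (\<ge>) hs" "sorted_wrt (\<ge>) hs'"
    and "\<And>h. h \<in> set hs \<union> set hs' \<Longrightarrow> 1 \<le> h \<and> h \<le> d"
    and eq: "\<And>i. 1 \<le> i \<Longrightarrow> i \<le> d \<Longrightarrow> length (filter (\<lambda>h. i \<le> h) hs) = length (filter (\<lambda>h. i \<le> h) hs')"
  shows "hs = hs'"
proof -
  have split: "length (filter (\<lambda>h. i \<le> h) xs) = count_list xs i + length (filter (\<lambda>h. Suc i \<le> h) xs)"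
    for i and xs :: "nat list"
    by (induction xs) auto
  have big: "length (filter (\<lambda>h. i \<le> h) hs) = length (filter (\<lambda>h. i \<le> h) hs')" if "1 \<le> i" for i
  proof (cases "i \<le> d")
    case False
    then have "filter (\<lambda>h. i \<le> h) hs = []" "filter (\<lambda>h. i \<le> h) hs' = []"
      using assms(3) by (fastforce simp: filter_empty_conv)+
    then show ?thesis by simp
  qed (use that eq in blast)
  have "count_list hs i = count_list hs' i" for i
  proof (cases i)
    case 0
    then have "i \<notin> set hs" "i \<notin> set hs'" using assms(3) by force+
    then show ?thesis by (simp add: count_notin)
  next
    case (Suc j)
    then show ?thesis using split[of i hs] split[of i hs'] big[of i] big[of "Suc i"] by simp
  qed
  then have "mset (rev hs) = mset (rev hs')" by (simp add: multiset_eq_iff count_mset)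
  moreover have "sorted (rev hs)" "sorted (rev hs')"
    using assms(1,2) by (simp_all add: sorted_wrt_rev)
  ultimately show ?thesis by (metis properties_for_sort rev_rev_ident)
qed

lemma steps_shape: "(step d)\<^sup>*\<^sup>* u v \<Longrightarrow> shape u = shape v"
  by (metis steps_Q_tab shape_Q_tab)

text \<open>The letter \<open>i\<close> in \<open>w\<close> and the letter \<open>d + 1 - i\<close>
  in the dual word are equally frequent, and each frequency counts the columns of height at least
  \<open>i\<close> in the respective insertion tableau.\<close>

lemma shape_dual_word:
  assumes w: "yamanouchi w" "set w \<subseteq> {1..d}"
  shows "shape (dual_word d w) = shape w"
proof (rule decreasing_lists_eqI[OF shape_decreasing shape_decreasing])
  have s: "set (dual_word d w) \<subseteq> {1..d}" using set_dual_word[OF w(2)] .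
  show "1 \<le> h \<and> h \<le> d" if "h \<in> set (shape (dual_word d w)) \<union> set (shape w)" for h
    using that shape_bounds[OF s] shape_bounds[OF w(2)] by blast
  fix i assume i: "1 \<le> i" "i \<le> d"
  have "lowest d (dual_word d w)"
    using yamanouchi_dual_word[OF s] w dual_word_dual_word[OF w(2)] by simp
  then have "P_tab (dual_word d w) = top_tab d (shape (dual_word d w))"
    using s by (rule P_tab_lowest)
  moreover have "\<forall>h\<in>set (shape (dual_word d w)). h \<le> d" using shape_bounds[OF s] by blast
  ultimately have "count_list (dual_word d w) (d + 1 - i) = length (filter (\<lambda>h. i \<le> h) (shape (dual_word d w)))"
    using count_top_tab[OF i] count_list_P_tab by metis
  moreover have "P_tab w = bottom_tab (shape w)" using w by (intro P_tab_yamanouchi) auto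
  then have "count_list w i = length (filter (\<lambda>h. i \<le> h) (shape w))"
    using count_bottom_tab[OF i(1)] count_list_P_tab by metis
  ultimately show "length (filter (\<lambda>h. i \<le> h) (shape (dual_word d w))) = length (filter (\<lambda>h. i \<le> h) (shape w))"
    using count_dual_word[OF w(2) i] by simp
qed

text \<open>Both are lowest weight tableaux; \<open>u\<close> has the shape of \<open>w\<close>
  because lowering keeps the recording tableau.\<close>

lemma P_tab_lowest_eq_dual_word:
  assumes w: "yamanouchi w" "set w \<subseteq> {1..d}" and u: "(step d)\<^sup>*\<^sup>* w u" "lowest d u"
  shows "P_tab u = P_tab (dual_word d w)"
proof -
  have s: "set (dual_word d w) \<subseteq> {1..d}" using set_dual_word[OF w(2)] .
  have "lowest d (dual_word d w)"
    using yamanouchi_dual_word[OF s] w dual_word_dual_word[OF w(2)] by simp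
  then have "P_tab (dual_word d w) = top_tab d (shape (dual_word d w))"
    using s by (rule P_tab_lowest)
  moreover have "P_tab u = top_tab d (shape u)" using u steps_set w by (intro P_tab_lowest) auto
  ultimately show ?thesis using shape_dual_word[OF w] steps_shape[OF u(1)] by simp
qed

lemma P_tab_dual_word_lowest:
  assumes w: "yamanouchi w" "set w \<subseteq> {1..d}" and u: "(step d)\<^sup>*\<^sup>* w u" "lowest d u"
  shows "P_tab (dual_word d u) = P_tab w"
proof -
  have su: "set u \<subseteq> {1..d}" using steps_set[OF u(1)] w by blast
  have "yamanouchi (dual_word d u)" using yamanouchi_dual_word[OF su] u by simp
  moreover have "set (dual_word d u) \<subseteq> {1..d}" using set_dual_word[OF su] .
  ultimately have "P_tab (dual_word d u) = bottom_tab (shape (dual_word d u))"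
    by (intro P_tab_yamanouchi) auto
  also have "shape (dual_word d u) = shape w"
    using steps_shape[OF steps_dual_word[OF u(1) w(2)]] shape_dual_word[OF w] by simp
  also have "bottom_tab (shape w) = P_tab w" using w by (intro P_tab_yamanouchi[symmetric]) auto
  finally show ?thesis .
qed


section \<open>Fillings, rotation and lowering\<close>

text \<open>With the reading order as a list of boxes, positions in a word correspond to boxes and
  rotation becomes list reversal.\<close>

definition boxes :: "nat \<Rightarrow> nat \<Rightarrow> (nat \<times> nat) list" where
  "boxes d n = concat (map (\<lambda>i. map (Pair i) (rev [1..<n - d + 1])) [1..<d + 1])"

lemma set_boxes [simp]: "set (boxes d n) = rectangle d n"
  by (auto simp: boxes_def rectangle_def image_iff simp del: upt_Suc)

lemma distinct_boxes: "distinct (boxes d n)"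
proof -
  have "distinct (concat (map (\<lambda>i. map (Pair i) ys) xs))"
    if "distinct xs" "distinct ys" for xs :: "nat list" and ys :: "nat list"
    using that by (induction xs) (auto simp: distinct_map inj_on_def)
  then show ?thesis unfolding boxes_def by simp
qed

definition entries :: "filling \<Rightarrow> (nat \<times> nat) list \<Rightarrow> nat list" where
  "entries T bs = map (the \<circ> T) (filter (\<lambda>b. b \<in> dom T) bs)"

lemma entries_append [simp]: "entries T (bs @ bs') = entries T bs @ entries T bs'"
  and entries_Nil [simp]: "entries T [] = []"
  by (simp_all add: entries_def)

lemma word_eq_entries: "word d n T = entries T (boxes d n)"
proof -
  have "List.map_filter (\<lambda>j. T (i, j)) js = entries T (map (Pair i) js)" for i js
    by (induction js) (auto simp: List.map_filter_def entries_def)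
  moreover have "concat (map (\<lambda>i. entries T (f i)) xs) = entries T (concat (map f xs))"
    for f and xs :: "nat list"
    by (induction xs) auto
  ultimately show ?thesis by (simp add: word_def boxes_def del: upt_Suc)
qed

lemma set_word: "dom T \<subseteq> rectangle d n \<Longrightarrow> set (word d n T) = ran T"
proof -
  assume "dom T \<subseteq> rectangle d n"
  then have "{b \<in> rectangle d n. b \<in> dom T} = dom T" by blast
  then have "set (word d n T) = (the \<circ> T) ` dom T"
    by (simp add: word_eq_entries entries_def del: mem_Collect_eq)
  also have "\<dots> = ran T"
  proof (intro equalityI subsetI)
    fix x assume "x \<in> ran T"
    then obtain b where "T b = Some x" unfolding ran_def by blast
    then show "x \<in> (the \<circ> T) ` dom T" by (intro rev_image_eqI[of b]) auto
  qed (auto intro: ranI)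
  finally show ?thesis .
qed

lemma count_entries:
  "distinct bs \<Longrightarrow> count_list (entries T bs) k = card {b \<in> set bs. T b = Some k}"
proof (induction bs)
  case (Cons b bs)
  let ?S = "{x \<in> set bs. T x = Some k}"
  have 1: "{x \<in> set (b # bs). T x = Some k} = (if T b = Some k then insert b ?S else ?S)"
    by auto
  have 2: "count_list (entries T (b # bs)) k =
      (if T b = Some k then Suc (count_list (entries T bs) k) else count_list (entries T bs) k)"
    by (cases "T b") (auto simp: entries_def)
  have 3: "count_list (entries T bs) k = card ?S" using Cons by auto
  have 4: "card (insert b ?S) = Suc (card ?S)" using Cons.prems by (intro card_insert_disjoint) auto
  show ?case
    unfolding 1 2 3 by (cases "T b = Some k") (simp_all only: 4 if_True if_False simp_thms)
qed (simp add: entries_def)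

lemma count_word:
  assumes "dom T \<subseteq> rectangle d n"
  shows "count_list (word d n T) k = card {b. T b = Some k}"
proof -
  have "{b \<in> rectangle d n. T b = Some k} = {b. T b = Some k}" using assms by auto
  then show ?thesis using count_entries[OF distinct_boxes[of d n], of T k] by (simp add: word_eq_entries)
qed

lemma word_inj:
  assumes "dom T = dom U" "dom T \<subseteq> rectangle d n" "word d n T = word d n U"
  shows "T = U"
proof
  fix b
  show "T b = U b"
  proof (cases "b \<in> dom T")
    case True
    then have "b \<in> set (filter (\<lambda>b. b \<in> dom T) (boxes d n))" using assms(2) by auto
    moreover have "map (the \<circ> T) (filter (\<lambda>b. b \<in> dom T) (boxes d n)) =
        map (the \<circ> U) (filter (\<lambda>b. b \<in> dom T) (boxes d n))"
      using assms(3) by (simp add: word_eq_entries entries_def assms(1))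
    ultimately have "the (T b) = the (U b)" unfolding map_eq_conv comp_apply by blast
    moreover obtain x y where "T b = Some x" "U b = Some y" using True assms(1) by blast
    ultimately show ?thesis by simp
  next
    case False
    then have "b \<notin> dom U" using assms(1) by blast
    with False show ?thesis by (simp add: domIff)
  qed
qed

section \<open>Rotation of fillings\<close>

definition rotate_box :: "nat \<Rightarrow> nat \<Rightarrow> nat \<times> nat \<Rightarrow> nat \<times> nat" where
  "rotate_box d n b = (d + 1 - fst b, n - d + 1 - snd b)"

lemma rotate_box_rectangle:
  "b \<in> rectangle d n \<Longrightarrow> rotate_box d n b \<in> rectangle d n \<and> rotate_box d n (rotate_box d n b) = b"
  by (auto simp: rotate_box_def rectangle_def)

lemma rotate_tab_apply:
  "rotate_tab d n T b = (if b \<in> rectangle d n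
     then map_option (\<lambda>k. d + 1 - k) (T (rotate_box d n b)) else None)"
  by (auto simp: rotate_tab_def rotate_box_def split: prod.splits)

lemma dom_rotate_tab: "dom (rotate_tab d n T) = {b \<in> rectangle d n. rotate_box d n b \<in> dom T}"
  by (auto simp: dom_def rotate_tab_apply split: if_splits)

lemma dom_rotate_tab_subset: "dom (rotate_tab d n T) \<subseteq> rectangle d n"
  by (auto simp: dom_rotate_tab)

lemma rotate_tab_rotate_tab:
  assumes "dom T \<subseteq> rectangle d n" "ran T \<subseteq> {1..d}"
  shows "rotate_tab d n (rotate_tab d n T) = T"
proof
  fix b
  show "rotate_tab d n (rotate_tab d n T) b = T b"
  proof (cases "T b")
    case None
    then show ?thesis by (auto simp: rotate_tab_apply rotate_box_rectangle)
  next
    case (Some k)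
    then have "b \<in> rectangle d n" "k \<in> {1..d}" 
      using subsetD[OF assms(1) domI] subsetD[OF assms(2) ranI] by auto
    then show ?thesis using Some by (auto simp: rotate_tab_apply rotate_box_rectangle)
  qed
qed

lemma rev_upt_eq_map: "rev [1..<m + 1] = map (\<lambda>i. m + 1 - i) [1..<m + 1]"
  by (rule nth_equalityI) (auto simp: rev_nth simp del: upt_Suc)

lemma rev_boxes: "rev (boxes d n) = map (rotate_box d n) (boxes d n)"
proof -
  have "rev (boxes d n) = concat (map (\<lambda>i. map (Pair i) [1..<n - d + 1]) (rev [1..<d + 1]))"
    by (simp add: boxes_def rev_concat rev_map o_def del: upt_Suc)
  also have "\<dots> = concat (map (\<lambda>i. map (Pair (d + 1 - i)) [1..<n - d + 1]) [1..<d + 1])"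
    unfolding rev_upt_eq_map[of d] by (simp add: o_def del: upt_Suc)
  also have "\<dots> = concat (map (\<lambda>i. map (rotate_box d n) (map (Pair i) (rev [1..<n - d + 1]))) [1..<d + 1])"
  proof -
    have "[1..<n - d + 1] = map (\<lambda>j. n - d + 1 - j) (rev [1..<n - d + 1])"
      using arg_cong[OF rev_upt_eq_map[of "n - d"], of rev] by (simp add: rev_map del: upt_Suc)
    then have "map (Pair (d + 1 - i)) [1..<n - d + 1] =
        map (Pair (d + 1 - i)) (map (\<lambda>j. n - d + 1 - j) (rev [1..<n - d + 1]))" for i
      by (rule arg_cong)
    also have "\<dots> i = map (rotate_box d n) (map (Pair i) (rev [1..<n - d + 1]))" for i
      by (simp add: rotate_box_def del: upt_Suc)
    finally have "map (Pair (d + 1 - i)) [1..<n - d + 1] =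
        map (rotate_box d n) (map (Pair i) (rev [1..<n - d + 1]))" for i .
    then show ?thesis by (simp only:)
  qed
  finally show ?thesis by (simp add: boxes_def map_concat o_def del: upt_Suc)
qed

lemma word_rotate_tab: "word d n (rotate_tab d n T) = dual_word d (word d n T)"
proof -
  let ?R = "rotate_tab d n T"
  have "dual_word d (word d n T) = map (\<lambda>k. d + 1 - k) (entries T (rev (boxes d n)))"
    by (simp add: dual_word_def word_eq_entries entries_def rev_map rev_filter)
  also have "\<dots> = map (\<lambda>b. d + 1 - the (T (rotate_box d n b))) (filter (\<lambda>b. rotate_box d n b \<in> dom T) (boxes d n))"
    unfolding rev_boxes by (simp add: entries_def filter_map o_def)
  also have "filter (\<lambda>b. rotate_box d n b \<in> dom T) (boxes d n) = filter (\<lambda>b. b \<in> dom ?R) (boxes d n)"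
    by (rule filter_cong) (auto simp: dom_rotate_tab)
  also have "map (\<lambda>b. d + 1 - the (T (rotate_box d n b))) \<dots> = map (the \<circ> ?R) \<dots>"
    by (rule map_cong) (auto simp: rotate_tab_apply)
  finally show ?thesis by (simp add: word_eq_entries entries_def)
qed

lemma ran_rotate_tab:
  assumes "ran T \<subseteq> {1..d}"
  shows "ran (rotate_tab d n T) \<subseteq> {1..d}"
proof
  fix y assume "y \<in> ran (rotate_tab d n T)"
  then obtain b where "rotate_tab d n T b = Some y" by (auto simp: ran_def)
  then obtain x where "T (rotate_box d n b) = Some x" "y = d + 1 - x"
    by (auto simp: rotate_tab_apply split: if_splits)
  moreover from this have "x \<in> {1..d}" using subsetD[OF assms ranI] by simp
  ultimately show "y \<in> {1..d}" by auto
qed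

lemma semistandard_rotate_tab:
  assumes T: "semistandard T" "ran T \<subseteq> {1..d}"
  shows "semistandard (rotate_tab d n T)"
proof -
  have R: "\<exists>k. T (d + 1 - i, n - d + 1 - j) = Some k \<and> x = d + 1 - k \<and> 1 \<le> k \<and> k \<le> d
      \<and> 1 \<le> i \<and> i \<le> d \<and> 1 \<le> j \<and> j \<le> n - d"
    if "rotate_tab d n T (i, j) = Some x" for i j x
  proof -
    from that obtain k where "T (d + 1 - i, n - d + 1 - j) = Some k" "x = d + 1 - k" "(i, j) \<in> rectangle d n"
      by (auto simp: rotate_tab_apply rotate_box_def split: if_splits)
    moreover from this have "k \<in> {1..d}" using subsetD[OF T(2) ranI] by simp
    ultimately show ?thesis by (auto simp: rectangle_def)
  qed
  have "x \<le> y"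
    if lt: "j < j'" and x: "rotate_tab d n T (i, j) = Some x" and y: "rotate_tab d n T (i, j') = Some y"
    for i j j' x y
  proof -
    obtain k where k: "T (d + 1 - i, n - d + 1 - j) = Some k" "x = d + 1 - k" using R[OF x] by blast
    obtain l where l: "T (d + 1 - i, n - d + 1 - j') = Some l" "y = d + 1 - l" "j' \<le> n - d"
      using R[OF y] by blast
    have "n - d + 1 - j' < n - d + 1 - j" using lt l(3) by simp
    then have "l \<le> k" using T(1) k(1) l(1) unfolding semistandard_def by blast
    then show ?thesis using k(2) l(2) by simp
  qed
  moreover have "x < y"
    if lt: "i < i'" and x: "rotate_tab d n T (i, j) = Some x" and y: "rotate_tab d n T (i', j) = Some y"
    for i i' j x y
  proof -
    obtain k where k: "T (d + 1 - i, n - d + 1 - j) = Some k" "x = d + 1 - k" "k \<le> d"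
      using R[OF x] by blast
    obtain l where l: "T (d + 1 - i', n - d + 1 - j) = Some l" "y = d + 1 - l" "i' \<le> d"
      using R[OF y] by blast
    have "d + 1 - i' < d + 1 - i" using lt l(3) by simp
    then have "l < k" using T(1) k(1) l(1) unfolding semistandard_def by blast
    then show ?thesis using k(2,3) l(2) by simp
  qed
  moreover have "0 \<notin> ran (rotate_tab d n T)" using ran_rotate_tab[OF T(2)] by force
  ultimately show ?thesis unfolding semistandard_def by blast
qed


section \<open>Lowering the entries of skew tableaux\<close>

text \<open>Skew diagrams are convex for the componentwise order of boxes; in this form the shape
  enters the lowering of fillings.\<close>

definition box_convex :: "(nat \<times> nat) set \<Rightarrow> bool" where
  "box_convex S \<longleftrightarrow> (\<forall>i j i' j' k l. (i, j) \<in> S \<and> (i', j') \<in> S \<and>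
     i \<le> k \<and> k \<le> i' \<and> j \<le> l \<and> l \<le> j' \<longrightarrow> (k, l) \<in> S)"

lemma box_convexD:
  "box_convex S \<Longrightarrow> (i, j) \<in> S \<Longrightarrow> (i', j') \<in> S \<Longrightarrow> i \<le> k \<Longrightarrow> k \<le> i' \<Longrightarrow> j \<le> l \<Longrightarrow> l \<le> j' \<Longrightarrow> (k, l) \<in> S"
  unfolding box_convex_def by blast

lemma upt_append: "a \<le> j \<Longrightarrow> j \<le> b \<Longrightarrow> [a..<b] = [a..<j] @ [j..<b]"
  using upt_add_eq_append[of a j "b - j"] by simp

lemma upt_split: "a \<le> j \<Longrightarrow> j < b \<Longrightarrow> [a..<b] = [a..<j] @ j # [Suc j..<b]"
  using upt_append[of a j b] by (simp add: upt_conv_Cons)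

text \<open>Exposes the boxes that matter when the entry of \<open>(r, j)\<close> changes: its right
  neighbour is read immediately before it, and the row above follows the rest of its own
  row.\<close>

lemma boxes_split:
  assumes "1 \<le> r" "r \<le> d" "1 \<le> j" "j \<le> n - d"
  shows "\<exists>X Y. boxes d n = X @ map (Pair r) (rev [Suc j..<n - d + 1]) @ (r, j) # map (Pair r) (rev [1..<j]) @ Y
    \<and> (r < d \<longrightarrow> (\<exists>Z. Y = map (Pair (Suc r)) (rev [1..<n - d + 1]) @ Z))"
proof -
  define row where "row i = map (Pair i) (rev [1..<n - d + 1])" for i :: nat
  have "[1..<d + 1] = [1..<r] @ r # [Suc r..<d + 1]" using assms by (intro upt_split) auto
  then have *: "boxes d n = concat (map row [1..<r]) @ row r @ concat (map row [Suc r..<d + 1])"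
    unfolding boxes_def row_def by (simp del: upt_Suc)
  have "[1..<n - d + 1] = [1..<j] @ j # [Suc j..<n - d + 1]" using assms by (intro upt_split) auto
  then have A: "row r = map (Pair r) (rev [Suc j..<n - d + 1]) @ (r, j) # map (Pair r) (rev [1..<j])"
    unfolding row_def by (simp del: upt_Suc)
  let ?Y = "concat (map row [Suc r..<d + 1])"
  have "boxes d n = concat (map row [1..<r]) @ map (Pair r) (rev [Suc j..<n - d + 1]) @
      (r, j) # map (Pair r) (rev [1..<j]) @ ?Y"
    by (simp only: * A append_assoc append_Cons)
  moreover have "?Y = row (Suc r) @ concat (map row [Suc (Suc r)..<d + 1])" if "r < d"
    using that by (simp add: upt_conv_Cons del: upt_Suc)
  then have "r < d \<longrightarrow> (\<exists>Z. ?Y = map (Pair (Suc r)) (rev [1..<n - d + 1]) @ Z)"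
    unfolding row_def by blast
  ultimately show ?thesis by blast
qed

lemma entries_split:
  assumes "distinct bs" "entries T bs = a @ x # b"
  shows "\<exists>bs1 p bs2. bs = bs1 @ p # bs2 \<and> T p = Some x \<and> a = entries T bs1 \<and> b = entries T bs2"
  using assms(2)
proof (induction bs arbitrary: a)
  case (Cons p bs)
  show ?case
  proof (cases "T p = None \<or> a \<noteq> []")
    case True
    then obtain a' where a': "entries T bs = a' @ x # b" "a = entries T [p] @ a'"
      using Cons.prems by (cases a) (auto simp: entries_def domIff split: if_splits)
    from Cons.IH[OF this(1)] obtain bs1 q bs2 where "bs = bs1 @ q # bs2" "T q = Some x" "a' = entries T bs1" "b = entries T bs2"
      by blast
    then show ?thesis using a' entries_append[of T "[p]" bs1] by (intro exI[of _ "p # bs1"]) auto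
  next
    case False
    then have "T p = Some x" "b = entries T bs" using Cons.prems by (auto simp: entries_def domIff split: if_splits)
    then show ?thesis using False by (intro exI[of _ "[]"]) auto
  qed
qed (simp add: entries_def)

lemma entries_upd_notin: "p \<notin> set bs \<Longrightarrow> p \<in> dom T \<Longrightarrow> entries (T(p \<mapsto> x)) bs = entries T bs"
  by (induction bs) (auto simp: entries_def)

text \<open>
  The box above one whose entry \<open>i\<close> is lowered to \<open>i + 1\<close> cannot contain \<open>i + 1\<close>: the \<open>i\<close>'s to the left
  of the lowered one all have an \<open>i + 1\<close> above them, so too many \<open>i + 1\<close>'s would follow in the word.
\<close>

lemma lowers_above:
  assumes T: "semistandard T" "box_convex (dom T)" "dom T \<subseteq> rectangle d n"
    and rj: "T (r, j) = Some i" and above: "T (r', j) = Some (Suc i)" "r < r'"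
    and b: "boxes d n = X @ (r, j) # Y" and clo: "clo i (entries T Y) = 0"
  shows False
proof -
  have row: "x \<le> y" if "l < l'" "T (k, l) = Some x" "T (k, l') = Some y" for k l l' x y
    using T(1) that unfolding semistandard_def by blast
  have col: "x < y" if "k < k'" "T (k, l) = Some x" "T (k', l) = Some y" for k k' l x y
    using T(1) that unfolding semistandard_def by blast
  have "(r, j) \<in> dom T" "(r', j) \<in> dom T" using rj above by auto
  then have "(Suc r, j) \<in> dom T" 
    using box_convexD[OF T(2), of r j r' j "Suc r" j] above(2) by simp
  then obtain z where z: "T (Suc r, j) = Some z" by auto
  have "r' = Suc r"
  proof (rule ccontr)
    assume "r' \<noteq> Suc r"
    then have "i < z" "z < Suc i" using col[of r "Suc r" j] col[of "Suc r" r' j] rj above z by auto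
    then show False by simp
  qed
  then have up: "T (Suc r, j) = Some (Suc i)" using above by simp
  have rect: "(r, j) \<in> rectangle d n" "(Suc r, j) \<in> rectangle d n" using T(3) rj up by blast+
  then have bounds: "1 \<le> r" "r < d" "1 \<le> j" "j \<le> n - d" by (auto simp: rectangle_def)
  then obtain X' Z where XZ: "boxes d n = (X' @ map (Pair r) (rev [Suc j..<n - d + 1])) @ (r, j) #
      map (Pair r) (rev [1..<j]) @ map (Pair (Suc r)) (rev [1..<n - d + 1]) @ Z"
    using boxes_split[of r d j n] by auto
  have "(r, j) \<notin> set X" "(r, j) \<notin> set Y" using distinct_boxes[of d n] unfolding b by auto
  then have Y: "Y = map (Pair r) (rev [1..<j]) @ map (Pair (Suc r)) (rev [1..<n - d + 1]) @ Z"
    using XZ unfolding b append_Cons_eq_iff[OF \<open>(r, j) \<notin> set X\<close> \<open>(r, j) \<notin> set Y\<close>] by blast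
  define k where "k = (LEAST k. T (r, k) = Some i)"
  have k: "T (r, k) = Some i" "k \<le> j" "\<And>l. T (r, l) = Some i \<Longrightarrow> k \<le> l"
    unfolding k_def using rj by (auto intro: LeastI Least_le)
  then have "1 \<le> k" using T(3) by (force simp: rectangle_def)
  have "[1..<n - d + 1] = [1..<k] @ [k..<n - d + 1]" using \<open>1 \<le> k\<close> k(2) bounds
    by (intro upt_append) auto
  \<comment> \<open>\<open>L\<close> runs from just after \<open>(r, j)\<close> to
    \<open>(Suc r, k)\<close>, where \<open>k\<close> is the leftmost column with \<open>i\<close>
    in row \<open>r\<close>. As a prefix of \<open>Y\<close> it has no unmatched
    \<open>i + 1\<close>; yet it contains \<open>i + 1\<close> in columns \<open>k\<close> to
    \<open>j\<close> of the upper row, and \<open>i\<close> only in columns \<open>k\<close> to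
    \<open>j - 1\<close> of the lower one.\<close>
  define L where "L = map (Pair r) (rev [1..<j]) @ map (Pair (Suc r)) (rev [k..<n - d + 1])"
  have "Y = L @ map (Pair (Suc r)) (rev [1..<k]) @ Z"
    unfolding Y L_def \<open>[1..<n - d + 1] = [1..<k] @ [k..<n - d + 1]\<close> by simp
  then have "clo i (entries T L) = 0" using clo by simp
  then have "count_list (entries T L) (Suc i) \<le> count_list (entries T L) i" by (rule count_le_of_clo)
  moreover have "distinct L" by (auto simp: L_def distinct_map inj_on_def)
  ultimately have le: "card {b \<in> set L. T b = Some (Suc i)} \<le> card {b \<in> set L. T b = Some i}"
    by (simp add: count_entries)
  have seg: "T (r, l) = Some i" if "k \<le> l" "l \<le> j" for l
  proof -
    have "(r, l) \<in> dom T" using box_convexD[OF T(2), of r k r j r l] k(1) rj that by auto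
    then obtain x where x: "T (r, l) = Some x" by auto
    then have "i \<le> x" "x \<le> i" using row[of k l r i x] row[of l j r x i] k(1) rj that by (cases "k = l"; cases "l = j"; auto)+
    with x show ?thesis by simp
  qed
  \<comment> \<open>The \<open>i\<close> underneath forces at least \<open>i + 1\<close>, and weak
    increase towards \<open>(Suc r, j)\<close> allows no more.\<close>
  have seg': "T (Suc r, l) = Some (Suc i)" if "k \<le> l" "l \<le> j" for l
  proof -
    have "(Suc r, l) \<in> dom T" using box_convexD[OF T(2), of r l "Suc r" j "Suc r" l] seg[OF that] up that by auto
    then obtain x where x: "T (Suc r, l) = Some x" by auto
    have "i < x" using col[of r "Suc r" l i x] seg[OF that] x by simp
    moreover have "x \<le> Suc i" using row[of l j "Suc r" x "Suc i"] x up that by (cases "l = j") auto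
    ultimately show ?thesis using x by simp
  qed
  have "Pair (Suc r) ` {k..j} \<subseteq> {b \<in> set L. T b = Some (Suc i)}"
    using seg' bounds by (auto simp: L_def)
  then have "card (Pair (Suc r) ` {k..j}) \<le> card {b \<in> set L. T b = Some (Suc i)}" by (intro card_mono) auto
  moreover have "{b \<in> set L. T b = Some i} \<subseteq> Pair r ` {k..<j}"
  proof -
    have "T (Suc r, l) \<noteq> Some i" if "k \<le> l" for l
    proof (cases "l \<le> j")
      case False
      then show ?thesis using row[of j l "Suc r" "Suc i" i] up by auto
    qed (use seg' that in auto)
    then show ?thesis using k(3) by (force simp: L_def)
  qed
  then have "card {b \<in> set L. T b = Some i} \<le> card (Pair r ` {k..<j})" by (intro card_mono) auto
  moreover have "card (Pair (Suc r) ` {k..j}) = Suc j - k" "card (Pair r ` {k..<j}) = j - k"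
    by (simp_all add: card_image inj_on_def)
  ultimately show False using le k(2) by simp
qed

text \<open>By weak increase an \<open>i\<close> further right forces one in the adjacent box, which
  is read immediately before \<open>(r, j)\<close>. As the last letter of the word of
  \<open>X\<close> it is unmatched there.\<close>

lemma lowers_right:
  assumes T: "semistandard T" "box_convex (dom T)" "dom T \<subseteq> rectangle d n"
    and rj: "T (r, j) = Some i" and right: "T (r, j') = Some i" "j < j'"
    and b: "boxes d n = X @ (r, j) # Y" and opn: "opn i (entries T X) = 0"
  shows False
proof -
  have row: "x \<le> y" if "l < l'" "T (k, l) = Some x" "T (k, l') = Some y" for k l l' x y
    using T(1) that unfolding semistandard_def by blast
  have rect: "(r, j) \<in> rectangle d n" "(r, j') \<in> rectangle d n" using T(3) rj right by blast+
  then have bounds: "1 \<le> r" "r \<le> d" "1 \<le> j" "j' \<le> n - d" by (auto simp: rectangle_def)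
  have "(r, Suc j) \<in> dom T" using box_convexD[OF T(2), of r j r j' r "Suc j"] rj right by auto
  then obtain x where x: "T (r, Suc j) = Some x" by auto
  then have "i \<le> x" "x \<le> i"
    using row[of j "Suc j" r i x] row[of "Suc j" j' r x i] rj right by (cases "j' = Suc j"; auto)+
  then have x: "T (r, Suc j) = Some i" using x by simp
  obtain X' Y' where XY: "boxes d n = (X' @ map (Pair r) (rev [Suc j..<n - d + 1])) @ (r, j) # Y'"
    using boxes_split[of r d j n] bounds right by auto
  have "(r, j) \<notin> set X" "(r, j) \<notin> set Y" using distinct_boxes[of d n] unfolding b by auto
  then have X: "X = X' @ map (Pair r) (rev [Suc j..<n - d + 1])"
    using XY unfolding b append_Cons_eq_iff[OF \<open>(r, j) \<notin> set X\<close> \<open>(r, j) \<notin> set Y\<close>] by blast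
  have "[Suc j..<n - d + 1] = Suc j # [Suc (Suc j)..<n - d + 1]" using bounds right by (simp add: upt_conv_Cons)
  then have "X = (X' @ map (Pair r) (rev [Suc (Suc j)..<n - d + 1])) @ [(r, Suc j)]" using X by (simp del: upt_Suc)
  moreover have "entries T [(r, Suc j)] = [i]" using x by (simp add: entries_def domIff)
  ultimately have "0 < opn i (entries T X)" by simp
  then show False using opn by simp
qed

text \<open>Lowering the word increases one entry by 1, so an inequality can only fail against an
  \<open>i\<close> to the right or an \<open>i + 1\<close> above; the two preceding lemmas exclude
  these.\<close>

lemma lowers_filling:
  assumes T: "semistandard T" "box_convex (dom T)" "dom T \<subseteq> rectangle d n"
    and F: "lowers i (word d n T) w"
  shows "\<exists>U. semistandard U \<and> dom U = dom T \<and> word d n U = w"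
proof -
  from F obtain a b where ab: "entries T (boxes d n) = a @ i # b" "w = a @ Suc i # b"
    "opn i a = 0" "clo i b = 0" unfolding lowers_def word_eq_entries by blast
  then obtain X p Y where XY: "boxes d n = X @ p # Y" "T p = Some i" "a = entries T X" "b = entries T Y"
    using entries_split[OF distinct_boxes ab(1)] by blast
  obtain r j where p: "p = (r, j)" by fastforce
  let ?U = "T(p \<mapsto> Suc i)"
  have p_notin: "p \<notin> set X" "p \<notin> set Y" "p \<in> dom T" using distinct_boxes[of d n] XY by auto
  have dom: "dom ?U = dom T" using XY by auto
  have "entries ?U (boxes d n) = entries ?U X @ entries ?U [p] @ entries ?U Y"
    using XY(1) entries_append[of ?U "[p]" Y] by simp
  also have "\<dots> = w" using p_notin ab XY by (simp add: entries_upd_notin) (simp add: entries_def)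
  finally have word: "word d n ?U = w" by (simp add: word_eq_entries)
  have row: "x \<le> y" if "l < l'" "T (k, l) = Some x" "T (k, l') = Some y" for k l l' x y
    using T(1) that unfolding semistandard_def by blast
  have col: "x < y" if "k < k'" "T (k, l) = Some x" "T (k', l) = Some y" for k k' l x y
    using T(1) that unfolding semistandard_def by blast
  have right: "Suc i \<le> y" if "j < j'" "T (r, j') = Some y" for j' y
  proof -
    have "y \<noteq> i" using lowers_right[OF T, of r j i j' X Y] that XY p ab by auto
    moreover have "i \<le> y" using row[of j j' r i y] that XY p by auto
    ultimately show ?thesis by simp
  qed
  have above: "Suc i < y" if "r < r'" "T (r', j) = Some y" for r' y
  proof -
    have "y \<noteq> Suc i" using lowers_above[OF T, of r j i r' X Y] that XY p ab by auto
    moreover have "i < y" using col[of r r' j i y] that XY p by auto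
    ultimately show ?thesis by simp
  qed
  have "x \<le> y" if "l < l'" "?U (k, l) = Some x" "?U (k, l') = Some y" for k l l' x y
  proof -
    consider "(k, l) = p" | "(k, l') = p" | "(k, l) \<noteq> p" "(k, l') \<noteq> p" by blast
    then show ?thesis
    proof cases
      case 1
      then show ?thesis using that right[of l' y] p by auto
    next
      case 2
      then show ?thesis using that row[of l l' k x i] XY(2) p by auto
    next
      case 3
      then show ?thesis using that row[of l l' k x y] by auto
    qed
  qed
  moreover have "x < y" if "k < k'" "?U (k, l) = Some x" "?U (k', l) = Some y" for k k' l x y
  proof -
    consider "(k, l) = p" | "(k', l) = p" | "(k, l) \<noteq> p" "(k', l) \<noteq> p" by blast
    then show ?thesis
    proof cases
      case 1
      then show ?thesis using that above[of k' y] p by auto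
    next
      case 2
      then show ?thesis using that col[of k k' l x i] XY(2) p by auto
    next
      case 3
      then show ?thesis using that col[of k k' l x y] by auto
    qed
  qed
  moreover have "0 \<notin> ran ?U" using T(1) by (auto simp: semistandard_def ran_def)
  ultimately have "semistandard ?U" unfolding semistandard_def by blast
  then show ?thesis using dom word by blast
qed

text \<open>Lowering stops because each step increases the sum of the letters by 1, while this sum
  is at most \<open>d\<close> times the length of the word.\<close>

lemma ex_lowest_filling:
  assumes "semistandard T" "box_convex (dom T)" "dom T \<subseteq> rectangle d n" "ran T \<subseteq> {1..d}"
  shows "\<exists>U. semistandard U \<and> dom U = dom T \<and> (step d)\<^sup>*\<^sup>* (word d n T) (word d n U) \<and> lowest d (word d n U)"
  using assms
proof (induction "d * length (word d n T) - sum_list (word d n T)" arbitrary: T rule: less_induct)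
  case less
  show ?case
  proof (cases "lowest d (word d n T)")
    case False
    then obtain w i where w: "step d (word d n T) w" "lowers i (word d n T) w"
      using lowest_or_step unfolding step_def by blast
    then obtain U where U: "semistandard U" "dom U = dom T" "word d n U = w"
      using lowers_filling less.prems by blast
    have "set (word d n T) \<subseteq> {1..d}" using set_word less.prems by simp
    then have sw: "set w \<subseteq> {1..d}" using step_set w by blast
    have "sum_list w \<le> d * length w"
      using sum_list_mono[of w "\<lambda>x. x" "\<lambda>_. d"] sw by (force simp: sum_list_triv mult.commute)
    then have "d * length w - sum_list w < d * length (word d n T) - sum_list (word d n T)"
      using step_sum_list[OF w(1)] step_length[OF w(1)] by simp
    moreover have "ran U \<subseteq> {1..d}" using set_word[of U d n] U less.prems sw by simp
    ultimately obtain V where "semistandard V" "dom V = dom U" "(step d)\<^sup>*\<^sup>* w (word d n V)" "lowest d (word d n V)"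
      using less.hyps[of U] U less.prems by auto
    then show ?thesis using w(1) U(2) by (metis converse_rtranclp_into_rtranclp)
  qed (use less.prems in blast)
qed


section \<open>Reversal of Littlewood--Richardson tableaux\<close>

text \<open>Both tableaux determine the word, and the word together with the shape determines the
  filling.\<close>

lemma reversal_eqI:
  assumes "dom T \<subseteq> rectangle d n" and U: "semistandard U" "dom U = dom T"
    and Q: "Q_tab (word d n U) = Q_tab (word d n T)"
    and P: "P_tab (word d n U) = P_tab (word d n (rotate_tab d n T))"
  shows "reversal d n T = U"
  unfolding reversal_def dual_equiv_def knuth_equiv_def
proof (rule the_equality)
  fix V
  assume V: "semistandard V \<and> dom V = dom T \<and>
    (dom V = dom T \<and> Q_tab (word d n V) = Q_tab (word d n T)) \<and>
    P_tab (word d n V) = P_tab (word d n (rotate_tab d n T))"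
  then have "word d n V = word d n U" using P Q by (intro PQ_tab_inj) simp_all
  then show "V = U" using V U assms(1) by (intro word_inj) simp_all
qed (use assms in simp)

section \<open>Complements and rotated skew shapes\<close>

lemma complement_nth:
  "partition_in d n p \<Longrightarrow> i < d \<Longrightarrow> complement d n p ! i = n - d - p ! (d - 1 - i)"
  by (simp add: partition_in_def complement_def rev_nth)

lemma partition_in_nth_le: "partition_in d n p \<Longrightarrow> i < d \<Longrightarrow> p ! i \<le> n - d"
  unfolding partition_in_def by (metis nth_mem)

lemma partition_in_antimono: "partition_in d n p \<Longrightarrow> i \<le> j \<Longrightarrow> j < d \<Longrightarrow> p ! j \<le> p ! i"
  unfolding partition_in_def by (cases "i = j") auto

lemma partition_in_complement:
  assumes "partition_in d n p"
  shows "partition_in d n (complement d n p)"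
proof -
  have "complement d n p ! j \<le> complement d n p ! i" if "i < j" "j < d" for i j
  proof -
    have "p ! (d - 1 - i) \<le> p ! (d - 1 - j)"
      using that by (intro partition_in_antimono[OF assms]) auto
    then show ?thesis using that assms by (simp add: complement_nth)
  qed
  moreover have "length (complement d n p) = d"
    using assms by (simp add: partition_in_def complement_def)
  moreover have "\<forall>x\<in>set (complement d n p). x \<le> n - d" by (auto simp: complement_def)
  ultimately show ?thesis unfolding partition_in_def by blast
qed

lemma skew_shape_subset:
  assumes "partition_in d n q"
  shows "skew_shape d q p \<subseteq> rectangle d n"
proof clarify
  fix i j assume "(i, j) \<in> skew_shape d q p"
  moreover from this have "i - 1 < d" by (auto simp: skew_shape_def)
  ultimately show "(i, j) \<in> rectangle d n"
    using partition_in_nth_le[OF assms, of "i - 1"] by (auto simp: skew_shape_def rectangle_def)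
qed

lemma box_convex_skew_shape:
  assumes p: "partition_in d n p" and q: "partition_in d n q"
  shows "box_convex (skew_shape d q p)"
  unfolding box_convex_def
proof (intro allI impI, elim conjE)
  fix i j i' j' k l
  assume *: "(i, j) \<in> skew_shape d q p" "(i', j') \<in> skew_shape d q p"
    "i \<le> k" "k \<le> i'" "j \<le> l" "l \<le> j'"
  then have "p ! (k - 1) \<le> p ! (i - 1)" "q ! (i' - 1) \<le> q ! (k - 1)"
    by (auto simp: skew_shape_def intro!: partition_in_antimono[OF p] partition_in_antimono[OF q])
  with * show "(k, l) \<in> skew_shape d q p" by (auto simp: skew_shape_def)
qed

lemma dom_rotate_tab_skew_shape:
  assumes mu: "partition_in d n mu" and lam: "partition_in d n lam"
    and T: "dom T = skew_shape d (complement d n lam) mu"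
  shows "dom (rotate_tab d n T) = skew_shape d (complement d n mu) lam"
proof -
  have "(i, j) \<in> rectangle d n \<and> rotate_box d n (i, j) \<in> dom T \<longleftrightarrow>
      (i, j) \<in> skew_shape d (complement d n mu) lam" for i j
  proof (cases "1 \<le> i \<and> i \<le> d")
    case True
    then have "complement d n lam ! (d - i) = n - d - lam ! (i - 1)"
      "complement d n mu ! (i - 1) = n - d - mu ! (d - i)" "lam ! (i - 1) \<le> n - d"
      using complement_nth[OF lam, of "d - i"] complement_nth[OF mu, of "i - 1"]
        partition_in_nth_le[OF lam, of "i - 1"] by auto
    \<comment> \<open>The column condition within one row, for \<open>m = n - d\<close>, with
      \<open>a\<close> the part of \<open>lam\<close> and \<open>b\<close> the part of
      \<open>mu\<close> that bound this row.\<close>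
    moreover have "b < m + 1 - j \<and> m + 1 - j \<le> m - a \<longleftrightarrow> a < j \<and> j \<le> m - b"
      if "1 \<le> j" "j \<le> m" "a \<le> m" for a b m :: nat
      using that by arith
    moreover have "d + 1 - i - 1 = d - i" by simp
    moreover have "1 \<le> d + 1 - i" "d + 1 - i \<le> d" using True by auto
    ultimately show ?thesis using True
      by (cases "1 \<le> j \<and> j \<le> n - d")
        (simp_all only: T rectangle_def rotate_box_def skew_shape_def fst_conv snd_conv
          mem_Collect_eq prod.case mem_Sigma_iff atLeastAtMost_iff simp_thms, auto, arith)
  qed (auto simp: rectangle_def skew_shape_def)
  then show ?thesis unfolding dom_rotate_tab by auto
qed

lemma contained_complement:
  assumes mu: "partition_in d n mu" and lam: "partition_in d n lam"
    and "contained d mu (complement d n lam)"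
  shows "contained d lam (complement d n mu)"
  unfolding contained_def
proof (intro allI impI)
  fix i assume i: "i < d"
  then have "mu ! (d - 1 - i) \<le> n - d - lam ! i"
    using assms(3)[unfolded contained_def, rule_format, of "d - 1 - i"]
      complement_nth[OF lam, of "d - 1 - i"] by simp
  then show "lam ! i \<le> complement d n mu ! i"
    using complement_nth[OF mu i] partition_in_nth_le[OF lam i] partition_in_nth_le[OF mu, of "d - 1 - i"] i
    by simp
qed

text \<open>\<open>rho d n T\<close> is the rotation of \<open>U\<close>. Rotating it back gives
  \<open>U\<close>, whose reversal is \<open>T\<close>, so one lowering chain also yields the
  involution.\<close>

lemma LR_reversal:
  assumes mu: "partition_in d n mu" and lam: "partition_in d n lam"
    and T: "T \<in> LR d n mu nu lam"
  shows "reversal d n (rotate_tab d n T) = rotate_tab d n (reversal d n T)"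
    and "rho d n T \<in> LR d n lam nu mu"
    and "rho d n (rho d n T) = T"
proof -
  from T have sub: "contained d mu (complement d n lam)"
    and dom: "dom T = skew_shape d (complement d n lam) mu"
    and ss: "semistandard T" and cont: "has_content d T nu" and yam: "yamanouchi (word d n T)"
    by (auto simp: LR_def)
  have rect: "dom T \<subseteq> rectangle d n"
    unfolding dom by (rule skew_shape_subset[OF partition_in_complement[OF lam]])
  have conv: "box_convex (dom T)"
    unfolding dom by (rule box_convex_skew_shape[OF mu partition_in_complement[OF lam]])
  have ran: "ran T \<subseteq> {1..d}"
  proof
    fix k assume "k \<in> ran T"
    then obtain b where "b \<in> {b. T b = Some k}" by (auto simp: ran_def)
    \<comment> \<open>An infinite set would have \<open>card\<close> 0 too; finiteness makes the
      content of an occurring entry nonzero.\<close>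
    moreover have "{b. T b = Some k} \<subseteq> rectangle d n" "finite (rectangle d n)"
      using rect by (auto simp: rectangle_def)
    then have "finite {b. T b = Some k}" by (rule finite_subset)
    ultimately have "card {b. T b = Some k} \<noteq> 0" by (metis card_0_eq empty_iff)
    then show "k \<in> {1..d}" using cont unfolding has_content_def by (metis atLeastAtMost_iff)
  qed
  have letters: "set (word d n T) \<subseteq> {1..d}" using set_word[OF rect] ran by simp
  obtain U where U: "semistandard U" "dom U = dom T"
    and steps: "(step d)\<^sup>*\<^sup>* (word d n T) (word d n U)" and low: "lowest d (word d n U)"
    using ex_lowest_filling[OF ss conv rect ran] by blast
  have rectU: "dom U \<subseteq> rectangle d n" using U rect by simp
  have lettersU: "set (word d n U) \<subseteq> {1..d}" using steps_set[OF steps letters] .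
  then have ranU: "ran U \<subseteq> {1..d}" using set_word[OF rectU] by simp
  let ?R = "rotate_tab d n"
  have Q: "Q_tab (word d n U) = Q_tab (word d n T)" using steps_Q_tab[OF steps] by simp
  have QR: "Q_tab (word d n (?R U)) = Q_tab (word d n (?R T))"
    unfolding word_rotate_tab using steps_Q_tab[OF steps_dual_word[OF steps letters]] .
  have P: "P_tab (word d n U) = P_tab (word d n (?R T))"
    unfolding word_rotate_tab using P_tab_lowest_eq_dual_word[OF yam letters steps low] .
  have PR: "P_tab (word d n (?R U)) = P_tab (word d n T)"
    unfolding word_rotate_tab using P_tab_dual_word_lowest[OF yam letters steps low] .
  have ssR: "semistandard (?R U)" using semistandard_rotate_tab[OF U(1) ranU] .
  have domR: "dom (?R U) = dom (?R T)" using U(2) by (simp add: dom_rotate_tab)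
  have revT: "reversal d n T = U" using reversal_eqI[OF rect U Q P] .
  have revRT: "reversal d n (?R T) = ?R U"
    using reversal_eqI[OF dom_rotate_tab_subset ssR domR QR] PR
    by (simp add: rotate_tab_rotate_tab[OF rect ran])
  have revU: "reversal d n U = T"
    using reversal_eqI[OF rectU ss U(2)[symmetric] Q[symmetric] PR[symmetric]] .
  show "reversal d n (?R T) = ?R (reversal d n T)" using revT revRT by simp
  show "rho d n (rho d n T) = T"
    by (simp add: rho_def revRT rotate_tab_rotate_tab[OF rectU ranU] revU)
  have "has_content d (?R U) nu"
  proof -
    \<comment> \<open>Equal insertion tableaux have equal content, and each has the content of its
      word.\<close>
    have "card {b. ?R U b = Some k} = card {b. T b = Some k}" for k
      using count_word[OF dom_rotate_tab_subset, of d n U k] count_word[OF rect, of k]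
        count_list_P_tab[of "word d n (?R U)" k] count_list_P_tab[of "word d n T" k] PR by simp
    then show ?thesis using cont by (simp add: has_content_def)
  qed
  moreover have "yamanouchi (word d n (?R U))"
    unfolding word_rotate_tab using yamanouchi_dual_word[OF lettersU] low by blast
  moreover have "dom (?R U) = skew_shape d (complement d n mu) lam"
    using dom_rotate_tab_skew_shape[OF mu lam] U(2) dom by simp
  ultimately show "rho d n T \<in> LR d n lam nu mu"
    using contained_complement[OF mu lam sub] ssR by (simp add: rho_def revRT LR_def)
qed

theorem theorem5p1:
  fixes d n :: nat and mu nu lam :: "nat list"
  assumes "0 < d" and "d < n"
    and "partition_in d n mu" and "partition_in d n nu" and "partition_in d n lam"
  shows "(\<forall>T \<in> LR d n mu nu lam.
            reversal d n (rotate_tab d n T) = rotate_tab d n (reversal d n T))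
    \<and> bij_betw (rho d n) (LR d n mu nu lam) (LR d n lam nu mu)
    \<and> (\<forall>T \<in> LR d n mu nu lam \<union> LR d n lam nu mu.
            rho d n T \<in> LR d n mu nu lam \<union> LR d n lam nu mu \<and> rho d n (rho d n T) = T)
    \<and> lr_coeff d n mu nu lam = lr_coeff d n lam nu mu"
proof -
  \<comment> \<open>Exchanging \<open>mu\<close> and \<open>lam\<close> gives the opposite
    direction, so \<open>rho\<close> serves as its own inverse.\<close>
  note forward = LR_reversal[OF assms(3,5)] and backward = LR_reversal[OF assms(5,3)]
  have bij: "bij_betw (rho d n) (LR d n mu nu lam) (LR d n lam nu mu)"
    by (rule bij_betw_byWitness[where f' = "rho d n"]) (use forward backward in auto)
  then have "lr_coeff d n mu nu lam = lr_coeff d n lam nu mu"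
    unfolding lr_coeff_def by (rule bij_betw_same_card)
  then show ?thesis using bij forward backward by blast
qed

end
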